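(* Let $S=K[t_1,\ldots,t_s]$ be a polynomial ring over a field $K$. Let $I$ be a monomial ideal of $S$ whose irreducible decomposition $I=\mathfrak{q}_1\cap\cdots\cap\mathfrak{q}_m$ is minimal, let $\alpha_i$ be the vector in $\mathbb{N}^s\setminus\{0\}$ such that $\mathfrak{q}_i=\mathfrak{q}_{\alpha_i}$, and let $B$ be the $s\times m$ matrix with column vectors $\alpha_1^{-1},\ldots,\alpha_m^{-1}$. If $I^{n}=I^{(n)}$ for all $n\geq 1$, then the following hold: (a) $\overline{I^n}=\overline{\mathfrak{q}_1^n}\cap\cdots\cap\overline{\mathfrak{q}_m^n}$ for all $n\geq 1$; (b) $\mathrm{NP}(I)=\mathcal{Q}(B)$, that is, $\mathrm{NP}(I)=\mathrm{IP}(I)$; (c) the vertices of $\mathcal{Q}(I)$ are precisely $\alpha_1^{-1},\ldots,\alpha_m^{-1}$.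
   Context: $\mathbb{N}=\{0,1,2,\ldots\}$, and $e_i$ is the $i$-th unit vector of $\mathbb{R}^s$. For $b=(b_1,\ldots,b_s)\in\mathbb{N}^s\setminus\{0\}$ set $\mathfrak{q}_b:=(\{t_i^{b_i}\mid b_i\geq 1\})\subset S$ and $b^{-1}:=\sum_{b_i\geq 1}b_i^{-1}e_i\in\mathbb{R}^s$. An ideal of $S$ is irreducible if it is not an intersection of two ideals properly containing it. A monomial ideal $I$ has a unique irreducible decomposition $I=\mathfrak{q}_1\cap\cdots\cap\mathfrak{q}_m$, where each $\mathfrak{q}_i$ is an irreducible monomial ideal of the form $\mathfrak{q}_i=\mathfrak{q}_{\alpha_i}$ with $\alpha_i\in\mathbb{N}^s\setminus\{0\}$, and $I\neq\bigcap_{i\neq j}\mathfrak{q}_i$ for each $j=1,\ldots,m$. This decomposition is called minimal if $\mathrm{rad}(\mathfrak{q}_i)\neq\mathrm{rad}(\mathfrak{q}_j)$ for $i\neq j$. For $n\ge 1$, the $n$-th symbolic power is defined using the minimal primes: if $\mathfrak p_1,\ldots,\mathfrak p_r$ are the minimal primes of $I$, then $I^{(n)}=\bigcap_{i=1}^r (I^nS_{\mathfrak p_i}\cap S)$. $\overline{L}$ denotes the integral closure of an ideal $L$. Write $t^a=t_1^{a_1}\cdots t_s^{a_s}$, and let $\{t^{v_1},\ldots,t^{v_q}\}$ be the minimal set of monomial generators of $I$. Let $A$ be the $s\times q$ matrix with columns $v_1,\ldots,v_q$. The covering polyhedron of $I$ is $\mathcal{Q}(I)=\{x\in\mathbb{R}^s\mid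 x\geq 0,\ xA\geq 1\}$, where $1=(1,\ldots,1)$ and inequalities are componentwise. The Newton polyhedron of $I$ is $\mathrm{NP}(I)=\mathbb{R}_+^s+\mathrm{conv}(v_1,\ldots,v_q)$, where $\mathbb{R}_+=\{\lambda\in\mathbb{R}\mid\lambda\ge 0\}$. The irreducible polyhedron of $I$ is $\mathrm{IP}(I)=\mathcal{Q}(B)=\{x\in\mathbb{R}^s\mid x\geq 0,\ xB\geq 1\}$, where $B$ is the matrix with columns $\alpha_1^{-1},\ldots,\alpha_m^{-1}$. *)

theory Defs
  imports
    "HOL-Analysis.Analysis"
    "HOL-Library.Poly_Mapping"
    "HOL-Computational_Algebra.Fraction_Field"
begin

text \<open>
  The polynomial ring \<open>K[t\<^sub>1, \<dots>, t\<^sub>s]\<close> is the monoid algebra \<open>('n \<Rightarrow>\<^sub>0 nat) \<Rightarrow>\<^sub>0 'k\<close>, where \<open>'n\<close> is a finite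
  type with \<open>s\<close> elements and \<open>'n \<Rightarrow>\<^sub>0 nat\<close> is the monoid of exponent vectors. The variables are linearly
  ordered because the library shows that this ring is an integral domain only in that case.
  Beware: \<open>\<le>\<close> on \<open>'n \<Rightarrow>\<^sub>0 nat\<close> is a lexicographic order, not divisibility of monomials.
\<close>

type_synonym 'n expo = "'n \<Rightarrow>\<^sub>0 nat"
type_synonym ('n, 'k) mpoly = "('n \<Rightarrow>\<^sub>0 nat) \<Rightarrow>\<^sub>0 'k"


section \<open>Ideals of a commutative ring\<close>

text \<open>Ideals are the submodules of the ring over itself: \<open>ideal.subspace I\<close> says that \<open>I\<close> is an ideal,
  and \<open>ideal.span G\<close> is the ideal generated by \<open>G\<close>.\<close>

interpretation ideal: module "(*) :: 'a::comm_ring_1 \<Rightarrow> 'a \<Rightarrow> 'a"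
  by unfold_locales (simp_all add: algebra_simps)

text \<open>As a rewrite rule, this would be the reverse of \<open>mult.assoc\<close>.\<close>

declare ideal.scale_scale [simp del]

definition ideal_mult :: "'a::comm_ring_1 set \<Rightarrow> 'a set \<Rightarrow> 'a set" where
  "ideal_mult I J = ideal.span {x * y | x y. x \<in> I \<and> y \<in> J}"

primrec ideal_power :: "'a::comm_ring_1 set \<Rightarrow> nat \<Rightarrow> 'a set" where
  "ideal_power I 0 = UNIV"
| "ideal_power I (Suc n) = ideal_mult I (ideal_power I n)"

definition radical :: "'a::comm_ring_1 set \<Rightarrow> 'a set" where
  "radical I = {x. \<exists>n\<ge>1. x ^ n \<in> I}"

definition irreducible_ideal :: "'a::comm_ring_1 set \<Rightarrow> bool" where
  "irreducible_ideal Q \<longleftrightarrow> ideal.subspace Q \<and>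
     \<not> (\<exists>J L. ideal.subspace J \<and> ideal.subspace L \<and> Q \<subset> J \<and> Q \<subset> L \<and> Q = J \<inter> L)"

definition prime_ideal :: "'a::comm_ring_1 set \<Rightarrow> bool" where
  "prime_ideal P \<longleftrightarrow> ideal.subspace P \<and> P \<noteq> UNIV \<and> (\<forall>x y. x * y \<in> P \<longrightarrow> x \<in> P \<or> y \<in> P)"

definition minimal_primes :: "'a::comm_ring_1 set \<Rightarrow> 'a set set" where
  "minimal_primes I = {P. prime_ideal P \<and> I \<subseteq> P \<and> (\<forall>P'. prime_ideal P' \<and> I \<subseteq> P' \<and> P' \<subseteq> P \<longrightarrow> P' = P)}"

text \<open>An element \<open>x\<close> is integral over \<open>I\<close> if \<open>x\<^sup>n + a\<^sub>1 x\<^sup>n\<^sup>-\<^sup>1 + \<dots> + a\<^sub>n = 0\<close> with \<open>a\<^sub>i\<close> in the \<open>i\<close>-th power of \<open>I\<close>.\<close>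

definition integral_closure :: "'a::comm_ring_1 set \<Rightarrow> 'a set" where
  "integral_closure I = {x. \<exists>n\<ge>1. \<exists>a. (\<forall>i\<in>{1..n}. a i \<in> ideal_power I i) \<and>
     x ^ n + (\<Sum>i=1..n. a i * x ^ (n - i)) = 0}"


section \<open>Localization and symbolic powers\<close>

text \<open>For a domain \<open>S\<close>, the localization \<open>S\<^sub>P\<close> at a prime ideal \<open>P\<close> is the usual subring of the fraction field.\<close>

definition localization_at :: "'a::idom set \<Rightarrow> 'a fract set" where
  "localization_at P = {Fract a h | a h. h \<notin> P}"

text \<open>\<open>J S\<^sub>P\<close>: the \<open>S\<^sub>P\<close>-linear combinations of (images of) elements of \<open>J\<close>.\<close>

definition localized_ideal :: "'a::idom set \<Rightarrow> 'a set \<Rightarrow> 'a fract set" where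
  "localized_ideal J P =
     {(\<Sum>x\<in>F. c x * Fract x 1) | F c. finite F \<and> F \<subseteq> J \<and> (\<forall>x\<in>F. c x \<in> localization_at P)}"

definition symbolic_power :: "'a::idom set \<Rightarrow> nat \<Rightarrow> 'a set" where
  "symbolic_power I n = (\<Inter>P\<in>minimal_primes I. {f. Fract f 1 \<in> localized_ideal (ideal_power I n) P})"


section \<open>Monomial ideals\<close>

definition monomial :: "'n expo \<Rightarrow> ('n, 'k::comm_ring_1) mpoly" where
  "monomial a = Poly_Mapping.single a 1"

definition var :: "'n \<Rightarrow> ('n, 'k::comm_ring_1) mpoly" where
  "var i = monomial (Poly_Mapping.single i 1)"

definition monomial_ideal :: "('n, 'k::comm_ring_1) mpoly set \<Rightarrow> bool" where
  "monomial_ideal I \<longleftrightarrow> (\<exists>G. I = ideal.span (monomial ` G))"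

text \<open>The set of exponents of the minimal set of monomial generators; existence and uniqueness are
  shown in \<open>minimal_generators_eq\<close> below.\<close>

definition minimal_generators :: "('n, 'k::comm_ring_1) mpoly set \<Rightarrow> 'n expo set" where
  "minimal_generators I =
     (THE G. I = ideal.span (monomial ` G) \<and> (\<forall>H. H \<subset> G \<longrightarrow> I \<noteq> ideal.span (monomial ` H)))"

definition q_ideal :: "'n expo \<Rightarrow> ('n, 'k::comm_ring_1) mpoly set" where
  "q_ideal b = ideal.span {var i ^ Poly_Mapping.lookup b i | i. Poly_Mapping.lookup b i \<ge> 1}"

text \<open>The components are indexed by a finite type \<open>'m\<close> with \<open>m\<close> elements.\<close>

definition irreducible_decomposition ::
    "('n, 'k::comm_ring_1) mpoly set \<Rightarrow> ('m \<Rightarrow> 'n expo) \<Rightarrow> bool" where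
  "irreducible_decomposition I \<alpha> \<longleftrightarrow>
     I = (\<Inter>j. q_ideal (\<alpha> j)) \<and>
     (\<forall>j. \<alpha> j \<noteq> 0 \<and> irreducible_ideal (q_ideal (\<alpha> j) :: ('n, 'k) mpoly set)) \<and>
     (\<forall>j. I \<noteq> (\<Inter>i\<in>UNIV - {j}. q_ideal (\<alpha> i)))"

definition minimal_irreducible_decomposition ::
    "('n, 'k::comm_ring_1) mpoly set \<Rightarrow> ('m \<Rightarrow> 'n expo) \<Rightarrow> bool" where
  "minimal_irreducible_decomposition I \<alpha> \<longleftrightarrow>
     irreducible_decomposition I \<alpha> \<and>
     (\<forall>i j. i \<noteq> j \<longrightarrow>
        radical (q_ideal (\<alpha> i) :: ('n, 'k) mpoly set) \<noteq> radical (q_ideal (\<alpha> j)))"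


section \<open>Polyhedra\<close>

definition expo_vec :: "'n::finite expo \<Rightarrow> real ^ 'n" where
  "expo_vec a = (\<chi> i. real (Poly_Mapping.lookup a i))"

definition inv_vec :: "'n::finite expo \<Rightarrow> real ^ 'n" where
  "inv_vec b = (\<Sum>i | Poly_Mapping.lookup b i \<ge> 1. inverse (real (Poly_Mapping.lookup b i)) *\<^sub>R axis i 1)"

text \<open>The polyhedron \<open>{x | x \<ge> 0, x C \<ge> 1}\<close> of a matrix \<open>C\<close>, given by the set of its columns.\<close>

definition Q_polyhedron :: "(real ^ 'n) set \<Rightarrow> (real ^ 'n) set" where
  "Q_polyhedron C = {x. (\<forall>i. 0 \<le> x $ i) \<and> (\<forall>c\<in>C. x \<bullet> c \<ge> 1)}"

definition covering_polyhedron :: "('n::finite, 'k::comm_ring_1) mpoly set \<Rightarrow> (real ^ 'n) set" where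
  "covering_polyhedron I = Q_polyhedron (expo_vec ` minimal_generators I)"

definition newton_polyhedron :: "('n::finite, 'k::comm_ring_1) mpoly set \<Rightarrow> (real ^ 'n) set" where
  "newton_polyhedron I =
     {x + y | x y. (\<forall>i. 0 \<le> x $ i) \<and> y \<in> convex hull (expo_vec ` minimal_generators I)}"

definition vertices :: "(real ^ 'n) set \<Rightarrow> (real ^ 'n) set" where
  "vertices P = {x. x extreme_point_of P}"


section \<open>The minimal set of monomial generators is well defined\<close>

lemma monomial_mult: "monomial a * monomial b = monomial (a + b)"
  by (simp add: monomial_def mult_single)

lemma keys_monomial [simp]: "Poly_Mapping.keys (monomial a :: ('n, 'k::comm_ring_1) mpoly) = {a}"
  by (simp add: monomial_def)

lemma monomial_in_span_iff:
  "(monomial a :: ('n, 'k::comm_ring_1) mpoly) \<in> ideal.span (monomial ` G) \<longleftrightarrow> (\<exists>g\<in>G. \<exists>c. a = g + c)"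
proof
  assume "(monomial a :: ('n, 'k) mpoly) \<in> ideal.span (monomial ` G)"
  moreover have "\<forall>b\<in>Poly_Mapping.keys f. \<exists>g\<in>G. \<exists>c. b = g + c" if "f \<in> ideal.span (monomial ` G)"
    for f :: "('n, 'k) mpoly"
    using that
  proof (induction rule: ideal.span_induct_alt)
    case base
    show ?case by simp
  next
    case (step h x f)
    from step.hyps obtain g where g: "g \<in> G" "x = monomial g" by (rule imageE)
    show ?case
    proof
      fix b assume "b \<in> Poly_Mapping.keys (h * x + f)"
      then have "b \<in> Poly_Mapping.keys (h * x) \<union> Poly_Mapping.keys f"
        by (rule subsetD[OF Poly_Mapping.keys_add])
      then show "\<exists>g\<in>G. \<exists>c. b = g + c"
      proof
        assume "b \<in> Poly_Mapping.keys (h * x)"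
        then have "b \<in> {c + d | c d. c \<in> Poly_Mapping.keys h \<and> d \<in> Poly_Mapping.keys x}"
          by (rule subsetD[OF keys_mult])
        then obtain c d where "b = c + d" "d \<in> Poly_Mapping.keys x" by (elim CollectE exE conjE)
        then have "b = g + c" unfolding g(2) keys_monomial by (simp only: singleton_iff add.commute)
        then show ?thesis using g(1) by (intro bexI exI)
      next
        assume "b \<in> Poly_Mapping.keys f"
        then show ?thesis by (rule bspec[OF step.IH])
      qed
    qed
  qed
  ultimately have "\<forall>b\<in>Poly_Mapping.keys (monomial a :: ('n, 'k) mpoly). \<exists>g\<in>G. \<exists>c. b = g + c"
    by blast
  then show "\<exists>g\<in>G. \<exists>c. a = g + c" by simp
next
  assume "\<exists>g\<in>G. \<exists>c. a = g + c"
  then obtain g c where "g \<in> G" "a = g + c" by blast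
  then have "(monomial a :: ('n, 'k) mpoly) = monomial c * monomial g"
    by (simp add: monomial_mult add.commute)
  moreover have "(monomial g :: ('n, 'k) mpoly) \<in> ideal.span (monomial ` G)"
    using \<open>g \<in> G\<close> by (intro ideal.span_base imageI)
  ultimately show "(monomial a :: ('n, 'k) mpoly) \<in> ideal.span (monomial ` G)"
    by (simp only: ideal.span_scale)
qed

lemma minimal_generators_eq:
  fixes I :: "('n::finite, 'k::comm_ring_1) mpoly set"
  assumes I: "monomial_ideal I"
  defines "D \<equiv> {a. monomial a \<in> I \<and> (\<forall>b c. monomial b \<in> I \<and> a = b + c \<longrightarrow> b = a)}"
  shows "minimal_generators I = D"
    and "\<exists>!G. I = ideal.span (monomial ` G) \<and> (\<forall>H. H \<subset> G \<longrightarrow> I \<noteq> ideal.span (monomial ` H))"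
proof -
  have D_in: "monomial a \<in> I" if "a \<in> D" for a
    using that by (simp add: D_def)
  have D_min: "b = a" if "a \<in> D" "monomial b \<in> I" "a = b + c" for a b c
    using that by (simp add: D_def)
  have not_D: "\<exists>b c. monomial b \<in> I \<and> a = b + c \<and> b \<noteq> a" if "a \<notin> D" "monomial a \<in> I" for a
    using that unfolding D_def by blast
  have sub: "D \<subseteq> G" if G: "I = ideal.span (monomial ` G)" for G
  proof
    fix a assume a: "a \<in> D"
    from D_in[OF a] have "\<exists>g\<in>G. \<exists>c. a = g + c"
      by (simp only: G monomial_in_span_iff)
    then obtain g c where g: "g \<in> G" "a = g + c" by blast
    then have "monomial g \<in> I" by (simp add: G ideal.span_base)
    from D_min[OF a this g(2)] g(1) show "a \<in> G" by simp
  qed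
  have below: "\<exists>d\<in>D. \<exists>c. a = d + c" if "monomial a \<in> I" for a
    using that
  proof (induction "\<Sum>i\<in>UNIV. Poly_Mapping.lookup a i" arbitrary: a rule: less_induct)
    case less
    show ?case
    proof (cases "a \<in> D")
      case True
      then show ?thesis by (intro bexI[of _ a] exI[of _ 0]) simp_all
    next
      case False
      then obtain b c where bc: "monomial b \<in> I" "a = b + c" "b \<noteq> a"
        using not_D less.prems by blast
      then have "c \<noteq> 0" by auto
      then obtain i where "Poly_Mapping.lookup c i > 0"
        by (metis gr0I lookup_zero poly_mapping_eqI)
      then have "(\<Sum>i\<in>UNIV. Poly_Mapping.lookup c i) > 0" by (intro sum_pos2[of _ i]) simp_all
      then have "(\<Sum>i\<in>UNIV. Poly_Mapping.lookup b i) < (\<Sum>i\<in>UNIV. Poly_Mapping.lookup a i)"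
        by (simp add: bc(2) lookup_add sum.distrib)
      from less.hyps[OF this bc(1)] obtain d e where "d \<in> D" "b = d + e" by blast
      then have "a = d + (e + c)" using bc(2) by (simp add: add.assoc)
      then show ?thesis using \<open>d \<in> D\<close> by blast
    qed
  qed
  have gen: "I = ideal.span (monomial ` D)"
  proof
    obtain G where G: "I = ideal.span (monomial ` G)"
      using I unfolding monomial_ideal_def by blast
    have "monomial g \<in> ideal.span (monomial ` D :: ('n, 'k) mpoly set)" if g: "g \<in> G" for g
    proof -
      have "monomial g \<in> I" using g by (simp add: G ideal.span_base)
      from below[OF this] show ?thesis by (simp only: monomial_in_span_iff)
    qed
    then have "monomial ` G \<subseteq> ideal.span (monomial ` D :: ('n, 'k) mpoly set)" by blast
    then show "I \<subseteq> ideal.span (monomial ` D)"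
      unfolding G by (rule ideal.span_minimal[OF _ ideal.subspace_span])
    have "monomial ` D \<subseteq> I" using D_in by blast
    moreover have "ideal.subspace I" by (simp only: G ideal.subspace_span)
    ultimately show "ideal.span (monomial ` D) \<subseteq> I" by (rule ideal.span_minimal)
  qed
  let ?P = "\<lambda>G. I = ideal.span (monomial ` G) \<and> (\<forall>H. H \<subset> G \<longrightarrow> I \<noteq> ideal.span (monomial ` H))"
  have 1: "?P D"
  proof (intro conjI allI impI notI)
    fix H assume "H \<subset> D" "I = ideal.span (monomial ` H)"
    with sub[of H] show False by blast
  qed (rule gen)
  have 2: "G = D" if G: "?P G" for G
  proof (rule ccontr)
    assume "G \<noteq> D"
    with sub[OF conjunct1[OF G]] have "D \<subset> G" by (simp add: psubset_eq eq_commute)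
    then have "I \<noteq> ideal.span (monomial ` D)" using conjunct2[OF G] by blast
    from this gen show False by (rule notE)
  qed
  show "minimal_generators I = D"
    unfolding minimal_generators_def by (rule the_equality[of ?P, OF 1 2])
  show "\<exists>!G. ?P G" by (rule ex1I[of ?P, OF 1 2])
qed

end

theory Submission
  imports Defs "Jordan_Normal_Form.Determinant"
begin

text \<open>
  Write \<open>I\<close> as the irredundant intersection of the ideals \<open>q_ideal (\<alpha> j)\<close> with distinct radicals. Let \<open>w\<^sub>j(a)\<close>, the
  \<open>weight\<close> below, be the inner product of \<open>inv_vec (\<alpha> j)\<close> with the exponent vector \<open>a\<close>. The \<open>n\<close>-th power of
  \<open>q_ideal (\<alpha> j)\<close> contains only monomials with \<open>w\<^sub>j \<ge> n\<close>, and it contains all those with \<open>w\<^sub>j \<ge> n + s\<close>, where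
  \<open>s\<close> is the number of variables.

  If the radical of \<open>q_ideal (\<alpha> k)\<close> is a minimal prime of \<open>I\<close>, then a monomial outside this prime carries
  \<open>q_ideal (\<alpha> k)\<close> into \<open>I\<close> (\<open>component_multiplier\<close>). So the symbolic power contains the intersection of the \<open>n\<close>-th powers of the
  components, and by hypothesis the ordinary power contains it as well. For \<open>n = 1\<close>, the components with minimal radical already
  suffice here, and irredundance excludes all other components (\<open>no_embedded_component\<close>).

  For the Newton polyhedron, suppose a point \<open>x\<close> with \<open>w\<^sub>j(x) \<ge> 1\<close> for all \<open>j\<close> is separated from it by a
  linear form. Rounding up the large multiples of \<open>x\<close> gives monomials in powers of \<open>I\<close> on which
  the linear form is too small (\<open>irreducible_subset_newton_polyhedron\<close>).

  Then \<open>w\<^sub>j(a) \<ge> k + 1\<close> for all \<open>j\<close> says that \<open>a\<close> is \<open>k + 1\<close> times a point of the Newton polyhedron. If \<open>I\<close> has at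
  most \<open>k + 1\<close> generators, one of them has a coefficient of at least \<open>1\<close> in \<open>a\<close> and can be split off. So if \<open>N\<^sub>k\<close> is the ideal
  of the monomials with all \<open>w\<^sub>j \<ge> k\<close>, then \<open>N\<^bsub>k+n\<^esub>\<close> is contained in \<open>I\<^sup>n N\<^sub>k\<close> for large \<open>k\<close>. A polynomial
  that is integral over the \<open>n\<close>-th powers of all components lies in \<open>N\<^sub>n\<close>, because the least value of \<open>w\<^sub>j\<close> on the terms of a polynomial
  is a valuation (\<open>integral_closure_weight\<close>). It multiplies \<open>N\<^sub>k\<close> into \<open>I\<^sup>n N\<^sub>k\<close>, and the determinant trick shows that it is
  integral over \<open>I\<^sup>n\<close> (\<open>integral_closure_if_multiplies\<close>).

  Finally, blocking duality turns the equality of polyhedra into the statement that every point of the covering polyhedron of \<open>I\<close>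
  dominates a convex combination of the points \<open>inv_vec (\<alpha> j)\<close> (\<open>blocking_duality\<close>), so it has no other vertices.
  Each of these points is a vertex, because the supports of the \<open>\<alpha> j\<close> are pairwise
  incomparable (\<open>inv_vec_extreme_point\<close>).
\<close>

section \<open>Powers of ideals and integral dependence\<close>

lemma subspace_ideal_mult [simp]: "ideal.subspace (ideal_mult I J)"
  by (simp add: ideal_mult_def)

lemma subspace_ideal_power [simp]: "ideal.subspace (ideal_power I n)"
  by (cases n) (simp_all add: ideal.subspace_UNIV)

lemma ideal_mult_memI: "x \<in> I \<Longrightarrow> y \<in> J \<Longrightarrow> x * y \<in> ideal_mult I J"
  unfolding ideal_mult_def by (rule ideal.span_base) blast

lemma ideal_mult_least:
  assumes "ideal.subspace L" "\<And>x y. x \<in> I \<Longrightarrow> y \<in> J \<Longrightarrow> x * y \<in> L"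
  shows "ideal_mult I J \<subseteq> L"
  unfolding ideal_mult_def using assms by (intro ideal.span_minimal) auto

lemma ideal_mult_mono: "I \<subseteq> I' \<Longrightarrow> J \<subseteq> J' \<Longrightarrow> ideal_mult I J \<subseteq> ideal_mult I' J'"
  by (rule ideal_mult_least) (auto intro: ideal_mult_memI)

lemma ideal_power_mono: "I \<subseteq> J \<Longrightarrow> ideal_power I n \<subseteq> ideal_power J n"
  by (induction n) (simp_all add: ideal_mult_mono)

lemma ideal_power_1:
  fixes I :: "'a::comm_ring_1 set"
  assumes "ideal.subspace I"
  shows "ideal_power I 1 = I"
proof
  have "ideal_mult I UNIV \<subseteq> I"
  proof (rule ideal_mult_least[OF assms])
    fix x y assume "x \<in> I"
    from ideal.subspace_scale[OF assms this, of y] show "x * y \<in> I" by (simp add: mult.commute)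
  qed
  then show "ideal_power I 1 \<subseteq> I" by simp
  show "I \<subseteq> ideal_power I 1"
  proof
    fix x assume "x \<in> I"
    from ideal_mult_memI[OF this, of 1 UNIV] show "x \<in> ideal_power I 1" by simp
  qed
qed

lemma integral_closure_mono:
  assumes "I \<subseteq> J"
  shows "integral_closure I \<subseteq> integral_closure J"
  unfolding integral_closure_def using ideal_power_mono[OF assms] by blast

text \<open>An element \<open>x\<close> is integral over \<open>J\<close> if and only if \<open>0 \<in> graded_values J x k 1\<close> for some \<open>k \<ge> 1\<close>. The
  coefficient \<open>e\<close> of \<open>x ^ k\<close> is a parameter in order to follow it through the sums and products of which a
  determinant consists.\<close>

definition graded_values :: "'a::comm_ring_1 set \<Rightarrow> 'a \<Rightarrow> nat \<Rightarrow> 'a \<Rightarrow> 'a set" where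
  "graded_values J x k e =
     {e * x ^ k + (\<Sum>i=1..k. a i * x ^ (k - i)) | a. \<forall>i\<in>{1..k}. a i \<in> ideal_power J i}"

lemma graded_values_add:
  assumes "y \<in> graded_values J x k e" "z \<in> graded_values J x k e'"
  shows "y + z \<in> graded_values J x k (e + e')"
proof -
  from assms obtain a b where
    a: "y = e * x ^ k + (\<Sum>i=1..k. a i * x ^ (k - i))" "\<forall>i\<in>{1..k}. a i \<in> ideal_power J i" and
    b: "z = e' * x ^ k + (\<Sum>i=1..k. b i * x ^ (k - i))" "\<forall>i\<in>{1..k}. b i \<in> ideal_power J i"
    unfolding graded_values_def by blast
  have "y + z = (e + e') * x ^ k + (\<Sum>i=1..k. (a i + b i) * x ^ (k - i))"
    by (simp add: a b algebra_simps sum.distrib)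
  moreover have "\<forall>i\<in>{1..k}. a i + b i \<in> ideal_power J i"
    using a(2) b(2) by (simp add: ideal.subspace_add)
  ultimately show ?thesis unfolding graded_values_def by (intro CollectI exI[of _ "\<lambda>i. a i + b i"]) simp
qed

lemma graded_values_scale:
  assumes "y \<in> graded_values J x k e"
  shows "c * y \<in> graded_values J x k (c * e)"
proof -
  from assms obtain a where
    a: "y = e * x ^ k + (\<Sum>i=1..k. a i * x ^ (k - i))" "\<forall>i\<in>{1..k}. a i \<in> ideal_power J i"
    unfolding graded_values_def by blast
  have "c * y = (c * e) * x ^ k + (\<Sum>i=1..k. (c * a i) * x ^ (k - i))"
    by (simp add: a algebra_simps sum_distrib_left)
  moreover have "\<forall>i\<in>{1..k}. c * a i \<in> ideal_power J i"
    using a(2) by (simp add: ideal.subspace_scale)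
  ultimately show ?thesis unfolding graded_values_def by (intro CollectI exI[of _ "\<lambda>i. c * a i"]) simp
qed

lemma graded_values_sum:
  assumes "finite A" "\<And>p. p \<in> A \<Longrightarrow> f p \<in> graded_values J x k (e p)"
  shows "sum f A \<in> graded_values J x k (sum e A)"
  using assms
proof (induction A rule: finite_induct)
  case empty
  have "0 \<in> ideal_power J i" for i by (rule ideal.subspace_0) simp
  then show ?case by (auto simp: graded_values_def intro!: exI[of _ "\<lambda>_. 0"])
next
  case (insert p A)
  then show ?case by (simp add: graded_values_add)
qed

lemma graded_values_mult_linear:
  assumes c: "c \<in> J" and y: "y \<in> graded_values J x k e"
  shows "(d * x - c) * y \<in> graded_values J x (Suc k) (d * e)"
proof -
  from y obtain a where
    a: "y = e * x ^ k + (\<Sum>i=1..k. a i * x ^ (k - i))" "\<forall>i\<in>{1..k}. a i \<in> ideal_power J i"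
    unfolding graded_values_def by blast
  (* The coefficients, extended by zero so that both products are sums over the same range of indices. *)
  define a' where "a' i = (if i = 0 then e else if i \<le> k then a i else 0)" for i
  have a'_0: "a' 0 = e" by (simp add: a'_def)
  have a': "a' i \<in> ideal_power J i" for i
    using a(2) by (auto simp: a'_def ideal.subspace_0)
  have y': "y = (\<Sum>i=0..k. a' i * x ^ (k - i))"
    by (simp add: a(1) sum.atLeast_Suc_atMost[of 0 k] a'_def)
  define b where "b i = d * a' i - c * a' (i - 1)" for i
  have "d * x * y = (\<Sum>i=0..k. d * a' i * x ^ (Suc k - i))"
    by (simp add: y' sum_distrib_left algebra_simps Suc_diff_le)
  also have "\<dots> = (\<Sum>i=0..Suc k. d * a' i * x ^ (Suc k - i))"
    by (simp add: a'_def)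
  also have "\<dots> = d * e * x ^ Suc k + (\<Sum>i=1..Suc k. d * a' i * x ^ (Suc k - i))"
    by (subst sum.atLeast_Suc_atMost) (simp_all add: a'_0 mult.assoc del: sum.cl_ivl_Suc)
  finally have 1: "d * x * y = \<dots>" .
  have 2: "c * y = (\<Sum>i=1..Suc k. c * a' (i - 1) * x ^ (Suc k - i))"
    unfolding y' sum_distrib_left One_nat_def sum.shift_bounds_cl_Suc_ivl by (simp add: mult.assoc)
  have "(d * x - c) * y = d * e * x ^ Suc k + (\<Sum>i=1..Suc k. b i * x ^ (Suc k - i))"
    by (simp only: left_diff_distrib 1 2 b_def sum_subtractf) simp
  moreover have "b i \<in> ideal_power J i" if "i \<in> {1..Suc k}" for i
  proof -
    from that obtain i' where i: "i = Suc i'" by (cases i) auto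
    have "c * a' i' \<in> ideal_power J i"
      unfolding i ideal_power.simps by (rule ideal_mult_memI[OF c a'])
    moreover have "d * a' i \<in> ideal_power J i" by (rule ideal.subspace_scale[OF _ a']) simp
    ultimately show ?thesis unfolding b_def i by (simp add: ideal.subspace_diff del: ideal_power.simps)
  qed
  ultimately show ?thesis unfolding graded_values_def by (intro CollectI exI[of _ b]) blast
qed

lemma graded_values_prod:
  assumes "finite A" "\<And>l. l \<in> A \<Longrightarrow> c l \<in> J"
  shows "(\<Prod>l\<in>A. d l * x - c l) \<in> graded_values J x (card A) (\<Prod>l\<in>A. d l)"
  using assms
proof (induction A rule: finite_induct)
  case empty
  then show ?case by (simp add: graded_values_def)
next
  case (insert l A)
  then show ?case by (simp add: graded_values_mult_linear)
qed

text \<open>Expanding the determinant of \<open>x - C\<close> by permutations gives the characteristic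
  polynomial of \<open>C\<close> at \<open>x\<close>. Its leading coefficient is found without separating the identity
  permutation: the same expansion of \<open>det 1\<close> yields \<open>1\<close>.\<close>

lemma det_in_graded_values:
  assumes C: "\<And>i j. i < n \<Longrightarrow> j < n \<Longrightarrow> C i j \<in> J"
  shows "det (mat n n (\<lambda>(i, j). (if i = j then 1 else 0) * x - C i j)) \<in> graded_values J x n 1"
proof -
  have perm: "p i < n" if "p permutes {0..<n}" "i < n" for p i
    using permutes_in_image[OF that(1), of i] that(2) by simp
  let ?P = "{p. p permutes {0..<n}}"
  let ?d = "\<lambda>i j. if i = (j::nat) then 1 else (0::'a)"
  have "(\<Sum>p\<in>?P. signof p * (\<Prod>i=0..<n. ?d i (p i) * x - C i (p i)))
      \<in> graded_values J x n (\<Sum>p\<in>?P. signof p * (\<Prod>i=0..<n. ?d i (p i)))"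
  proof (intro graded_values_sum graded_values_scale)
    fix p assume p: "p \<in> ?P"
    have "(\<Prod>i\<in>{0..<n}. ?d i (p i) * x - C i (p i))
        \<in> graded_values J x (card {0..<n}) (\<Prod>i\<in>{0..<n}. ?d i (p i))"
      by (rule graded_values_prod) (use p perm C in auto)
    then show "(\<Prod>i=0..<n. ?d i (p i) * x - C i (p i)) \<in> graded_values J x n (\<Prod>i=0..<n. ?d i (p i))"
      by simp
  qed (simp add: finite_permutations)
  also have "(\<Sum>p\<in>?P. signof p * (\<Prod>i=0..<n. ?d i (p i) * x - C i (p i)))
      = det (mat n n (\<lambda>(i, j). ?d i j * x - C i j))"
    using perm by (auto simp: det_def intro!: sum.cong prod.cong)
  also have "(\<Sum>p\<in>?P. signof p * (\<Prod>i=0..<n. ?d i (p i))) = det (1\<^sub>m n :: 'a mat)"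
    using perm by (auto simp: det_def intro!: sum.cong prod.cong)
  finally show ?thesis by simp
qed

text \<open>The determinant trick: an element that multiplies a nonzero finitely generated ideal into
  \<open>J\<close> times that ideal is a zero of the characteristic polynomial of a matrix over \<open>J\<close>.\<close>

lemma integral_closure_if_multiplies:
  fixes x :: "'a::idom"
  assumes J: "ideal.subspace J" and V: "finite V" "v \<in> V" "v \<noteq> 0"
    and mult: "\<And>v. v \<in> V \<Longrightarrow> x * v \<in> ideal_mult J (ideal.span V)"
  shows "x \<in> integral_closure J"
proof -
  let ?L = "{y. \<exists>c. (\<forall>u\<in>V. c u \<in> J) \<and> y = (\<Sum>u\<in>V. c u * u)}"
  have L: "ideal.subspace ?L"
    unfolding ideal.subspace_def
  proof (intro conjI allI ballI)
    show "0 \<in> ?L" using ideal.subspace_0[OF J] by (auto intro!: exI[of _ "\<lambda>_. 0"])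
    fix y z assume "y \<in> ?L" "z \<in> ?L"
    then obtain c d where "\<forall>u\<in>V. c u \<in> J" "y = (\<Sum>u\<in>V. c u * u)" "\<forall>u\<in>V. d u \<in> J" "z = (\<Sum>u\<in>V. d u * u)"
      by blast
    then show "y + z \<in> ?L"
      by (auto intro!: exI[of _ "\<lambda>u. c u + d u"] ideal.subspace_add[OF J] simp: algebra_simps sum.distrib)
  next
    fix r y assume "y \<in> ?L"
    then obtain c where "\<forall>u\<in>V. c u \<in> J" "y = (\<Sum>u\<in>V. c u * u)" by blast
    then show "r * y \<in> ?L"
      by (auto intro!: exI[of _ "\<lambda>u. r * c u"] ideal.subspace_scale[OF J] simp: algebra_simps sum_distrib_left)
  qed
  have "ideal_mult J (ideal.span V) \<subseteq> ?L"
  proof (rule ideal_mult_least[OF L])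
    fix j y assume j: "j \<in> J" and "y \<in> ideal.span V"
    then obtain c where "y = (\<Sum>u\<in>V. c u * u)"
      using ideal.span_finite[OF V(1)] by auto
    then show "j * y \<in> ?L"
      using ideal.subspace_scale[OF J j]
      by (auto intro!: exI[of _ "\<lambda>u. c u * j"] simp: algebra_simps sum_distrib_left)
  qed
  with mult have "\<forall>v\<in>V. \<exists>c. (\<forall>u\<in>V. c u \<in> J) \<and> x * v = (\<Sum>u\<in>V. c u * u)" by blast
  then obtain c where c: "\<And>v u. v \<in> V \<Longrightarrow> u \<in> V \<Longrightarrow> c v u \<in> J"
    and xv: "\<And>v. v \<in> V \<Longrightarrow> x * v = (\<Sum>u\<in>V. c v u * u)" by metis
  (* The generators form a nonzero vector in the kernel of x - c. *)
  define n where "n = card V"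
  obtain g where g: "bij_betw g {0..<n} V"
    using ex_bij_betw_nat_finite[OF V(1)] n_def by blast
  have gV: "g i \<in> V" if "i < n" for i using bij_betwE[OF g] that by simp
  have "n > 0" using V n_def card_gt_0_iff by blast
  let ?M = "mat n n (\<lambda>(i, j). (if i = j then 1 else 0) * x - c (g i) (g j))"
  let ?w = "vec n g"
  have "?M *\<^sub>v ?w = 0\<^sub>v n"
  proof (rule eq_vecI)
    fix i assume "i < dim_vec (0\<^sub>v n :: 'a vec)"
    then have i: "i < n" by simp
    have "vec_index (?M *\<^sub>v ?w) i = (\<Sum>j=0..<n. ((if i = j then 1 else 0) * x - c (g i) (g j)) * g j)"
      using i by (simp add: scalar_prod_def)
    also have "\<dots> = (\<Sum>j=0..<n. (if i = j then x * g j else 0)) - (\<Sum>j=0..<n. c (g i) (g j) * g j)"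
      unfolding sum_subtractf[symmetric] by (intro sum.cong) (auto simp: algebra_simps)
    also have "(\<Sum>j=0..<n. (if i = j then x * g j else 0)) = x * g i"
      using i by simp
    also have "(\<Sum>j=0..<n. c (g i) (g j) * g j) = (\<Sum>u\<in>V. c (g i) u * u)"
      by (rule sum.reindex_bij_betw[OF g])
    finally show "vec_index (?M *\<^sub>v ?w) i = vec_index (0\<^sub>v n) i"
      using i xv[OF gV[OF i]] by simp
  qed simp
  moreover have "?w \<noteq> 0\<^sub>v n"
  proof
    obtain i where i: "i < n" "g i = v" using g V(2) by (auto simp: bij_betw_def)
    assume "?w = 0\<^sub>v n"
    then have "vec_index ?w i = vec_index (0\<^sub>v n) i" by simp
    with i V(3) show False by simp
  qed
  moreover have "?w \<in> carrier_vec n" by simp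
  ultimately have "det ?M = 0"
    by (subst det_0_iff_vec_prod_zero[of _ n]) (simp, blast)
  moreover have "det ?M \<in> graded_values J x n 1"
    by (rule det_in_graded_values) (simp add: c gV)
  ultimately show ?thesis
    using \<open>n > 0\<close> unfolding integral_closure_def graded_values_def
    by (auto intro!: exI[of _ n])
qed

section \<open>Monomial ideals\<close>

definition upset :: "'n expo set \<Rightarrow> bool" where
  "upset U \<longleftrightarrow> (\<forall>a\<in>U. \<forall>c. a + c \<in> U)"

definition supported_on :: "'n expo set \<Rightarrow> ('n, 'k::comm_ring_1) mpoly set" where
  "supported_on U = {f. Poly_Mapping.keys f \<subseteq> U}"

lemma expo_divides_iff:
  "(\<exists>c. (a :: 'n expo) = g + c) \<longleftrightarrow> (\<forall>i. Poly_Mapping.lookup g i \<le> Poly_Mapping.lookup a i)"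
proof
  assume "\<forall>i. Poly_Mapping.lookup g i \<le> Poly_Mapping.lookup a i"
  then have "a = g + (a - g)"
    by (intro poly_mapping_eqI) (simp add: lookup_add lookup_minus)
  then show "\<exists>c. a = g + c" by blast
qed (auto simp: lookup_add)

lemma sum_single_eq: "(\<Sum>a\<in>Poly_Mapping.keys f. Poly_Mapping.single a (Poly_Mapping.lookup f a)) = f"
  by (intro poly_mapping_eqI)
     (auto simp: lookup_sum lookup_single when_def in_keys_iff sum.delta)

lemma monomial_in_supported_on [simp]:
  "(monomial a :: ('n, 'k::comm_ring_1) mpoly) \<in> supported_on U \<longleftrightarrow> a \<in> U"
  by (simp add: supported_on_def)

lemma zero_in_supported_on [simp]: "0 \<in> supported_on U"
  by (simp add: supported_on_def)

lemma supported_on_mono: "U \<subseteq> V \<Longrightarrow> supported_on U \<subseteq> supported_on V"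
  by (auto simp: supported_on_def)

lemma supported_on_add: "f \<in> supported_on U \<Longrightarrow> g \<in> supported_on U \<Longrightarrow> f + g \<in> supported_on U"
  using Poly_Mapping.keys_add[of f g] by (auto simp: supported_on_def)

lemma keys_uminus: "Poly_Mapping.keys (- f) = Poly_Mapping.keys (f :: 'a \<Rightarrow>\<^sub>0 'b::ab_group_add)"
  by (auto simp: in_keys_iff)

lemma supported_on_diff:
  "f \<in> supported_on U \<Longrightarrow> g \<in> supported_on U \<Longrightarrow> f - g \<in> supported_on U"
  using supported_on_add[of f U "- g"] keys_uminus[of g] by (simp add: supported_on_def)

lemma supported_on_sum:
  "(\<And>i. i \<in> A \<Longrightarrow> f i \<in> supported_on U) \<Longrightarrow> sum f A \<in> supported_on U"
  by (induction A rule: infinite_finite_induct) (auto intro: supported_on_add)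

lemma supported_on_mult:
  assumes "f \<in> supported_on A" "g \<in> supported_on B" "\<And>a b. a \<in> A \<Longrightarrow> b \<in> B \<Longrightarrow> a + b \<in> C"
  shows "f * g \<in> supported_on C"
  using keys_mult[of f g] assms unfolding supported_on_def by fast

lemma subspace_supported_on:
  assumes "upset U"
  shows "ideal.subspace (supported_on U :: ('n, 'k::comm_ring_1) mpoly set)"
  unfolding ideal.subspace_def
proof (intro conjI ballI allI)
  fix r f :: "('n, 'k) mpoly" assume "f \<in> supported_on U"
  then have "f * r \<in> supported_on U"
    by (rule supported_on_mult[of _ _ _ UNIV]) (use assms in \<open>auto simp: upset_def supported_on_def\<close>)
  then show "r * f \<in> supported_on U" by (simp add: mult.commute)
qed (auto intro: supported_on_add)

lemma upset_multiples: "upset {g + c | g c. g \<in> G}"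
  unfolding upset_def
proof (intro ballI allI)
  fix a d assume "a \<in> {g + c | g c. g \<in> G}"
  then obtain g c where "g \<in> G" "a + d = g + (c + d)" by (auto simp: add.assoc)
  then show "a + d \<in> {g + c | g c. g \<in> G}" by blast
qed

lemma span_monomials:
  "ideal.span (monomial ` G :: ('n, 'k::comm_ring_1) mpoly set) = supported_on {g + c | g c. g \<in> G}"
proof
  have "g \<in> {g + c | g c. g \<in> G}" if "g \<in> G" for g
    by (intro CollectI exI[of _ g] exI[of _ 0]) (simp add: that)
  then show "ideal.span (monomial ` G) \<subseteq> supported_on {g + c | g c. g \<in> G}"
    by (intro ideal.span_minimal subspace_supported_on upset_multiples) auto
  show "supported_on {g + c | g c. g \<in> G} \<subseteq> ideal.span (monomial ` G :: ('n, 'k) mpoly set)"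
  proof
    fix f :: "('n, 'k) mpoly" assume f: "f \<in> supported_on {g + c | g c. g \<in> G}"
    have "(\<Sum>a\<in>Poly_Mapping.keys f. Poly_Mapping.single a (Poly_Mapping.lookup f a)) \<in> ideal.span (monomial ` G)"
    proof (rule ideal.span_sum)
      fix a assume "a \<in> Poly_Mapping.keys f"
      with f have "(monomial a :: ('n, 'k) mpoly) \<in> ideal.span (monomial ` G)"
        unfolding monomial_in_span_iff supported_on_def by blast
      then have "Poly_Mapping.single 0 (Poly_Mapping.lookup f a) * monomial a \<in> ideal.span (monomial ` G)"
        by (rule ideal.span_scale)
      then show "Poly_Mapping.single a (Poly_Mapping.lookup f a) \<in> ideal.span (monomial ` G)"
        by (simp add: monomial_def mult_single)
    qed
    then show "f \<in> ideal.span (monomial ` G)" by (simp add: sum_single_eq)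
  qed
qed

lemma monomial_ideal_iff: "monomial_ideal I \<longleftrightarrow> (\<exists>U. upset U \<and> I = supported_on U)"
proof
  assume "monomial_ideal I"
  then obtain G where "I = supported_on {g + c | g c. g \<in> G}"
    unfolding monomial_ideal_def span_monomials by blast
  then show "\<exists>U. upset U \<and> I = supported_on U"
    using upset_multiples by blast
next
  assume "\<exists>U. upset U \<and> I = supported_on U"
  then obtain U where U: "upset U" "I = supported_on U" by blast
  have "U = {g + c | g c. g \<in> U}"
  proof
    show "U \<subseteq> {g + c | g c. g \<in> U}"
    proof
      fix a assume "a \<in> U"
      then show "a \<in> {g + c | g c. g \<in> U}"
        by (intro CollectI exI[of _ a] exI[of _ 0]) simp
    qed
  qed (use U(1) in \<open>auto simp: upset_def\<close>)
  then show "monomial_ideal I"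
    unfolding monomial_ideal_def span_monomials U(2) by (intro exI[of _ U]) simp
qed

lemma monomial_ideal_mem_iff:
  assumes "monomial_ideal I"
  shows "f \<in> I \<longleftrightarrow> (\<forall>a\<in>Poly_Mapping.keys f. monomial a \<in> I)"
  using assms unfolding monomial_ideal_iff by (auto simp: supported_on_def)

lemma subspace_monomial_ideal: "monomial_ideal I \<Longrightarrow> ideal.subspace I"
  by (auto simp: monomial_ideal_def)

lemma nat_nondecreasing_subseq:
  fixes s :: "nat \<Rightarrow> nat"
  obtains r where "strict_mono (r :: nat \<Rightarrow> nat)" "incseq (\<lambda>n. s (r n))"
proof -
  obtain r where r: "strict_mono r" "monoseq (\<lambda>n. s (r n))" using seq_monosub by blast
  show thesis
  proof (cases "incseq (\<lambda>n. s (r n))")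
    case False
    with r(2) have dec: "decseq (\<lambda>n. s (r n))" by (simp add: monoseq_iff)
    define N where "N = (ARG_MIN (\<lambda>n. s (r n)) n. True)"
    have "s (r N) \<le> s (r n)" for n
      unfolding N_def by (rule arg_min_nat_le) simp
    with dec have "s (r (n + N)) = s (r N)" for n
      by (intro antisym) (auto simp: decseq_def)
    then have "incseq (\<lambda>n. s (r (n + N)))" by (simp add: incseq_def)
    moreover have "strict_mono (\<lambda>n. r (n + N))" using r(1) by (simp add: strict_mono_def)
    ultimately show thesis using that by blast
  qed (use r that in blast)
qed

text \<open>Dickson's lemma: extracting nondecreasing subsequences for one coordinate after the other, one finds in
  every sequence of exponent vectors a subsequence that is nondecreasing in all coordinates. So an infinite
  set of them contains two comparable elements.\<close>

lemma finite_antichain: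
  fixes D :: "'n::finite expo set"
  assumes "\<And>a c. a \<in> D \<Longrightarrow> a + c \<in> D \<Longrightarrow> c = 0"
  shows "finite D"
proof (rule ccontr)
  assume "infinite D"
  then obtain f :: "nat \<Rightarrow> 'n expo" where f: "inj f" "range f \<subseteq> D"
    using infinite_countable_subset by blast
  have "\<exists>r. strict_mono r \<and> (\<forall>i\<in>A. incseq (\<lambda>n. Poly_Mapping.lookup (f (r n)) i))" for A :: "'n set"
  proof (induction A rule: finite_induct[OF finite])
    case 1
    show ?case by (auto intro!: exI[of _ id] simp: strict_mono_def)
  next
    case (2 i A)
    then obtain r where r: "strict_mono r" "\<forall>i\<in>A. incseq (\<lambda>n. Poly_Mapping.lookup (f (r n)) i)" by blast
    obtain r' where r': "strict_mono r'" "incseq (\<lambda>n. Poly_Mapping.lookup (f (r (r' n))) i)"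
      using nat_nondecreasing_subseq[of "\<lambda>n. Poly_Mapping.lookup (f (r n)) i"] by blast
    have "incseq (\<lambda>n. Poly_Mapping.lookup (f (r (r' n))) k)" if "k \<in> A" for k
      using r(2) that r'(1) by (auto simp: incseq_def strict_mono_less_eq)
    then show ?case
      using r' strict_mono_o[OF r(1) r'(1)] by (intro exI[of _ "r \<circ> r'"]) (auto simp del: o_apply simp: o_def)
  qed
  then obtain r where r: "strict_mono r" "\<forall>i. incseq (\<lambda>n. Poly_Mapping.lookup (f (r n)) i)" by blast
  then have "\<forall>i. Poly_Mapping.lookup (f (r 0)) i \<le> Poly_Mapping.lookup (f (r 1)) i"
    by (auto simp: incseq_def)
  then obtain c where c: "f (r 1) = f (r 0) + c" unfolding expo_divides_iff[symmetric] by blast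
  with assms[of "f (r 0)" c] f(2) have "c = 0" by (metis rangeI subsetD)
  with c have "f (r 1) = f (r 0)" by simp
  with f(1) r(1) show False by (auto simp: inj_eq strict_mono_eq)
qed

lemma
  fixes I :: "('n::finite, 'k::comm_ring_1) mpoly set"
  assumes "monomial_ideal I"
  shows finite_minimal_generators: "finite (minimal_generators I)"
    and span_minimal_generators: "I = ideal.span (monomial ` minimal_generators I)"
proof -
  show "finite (minimal_generators I)"
  proof (rule finite_antichain)
    fix a c assume "a \<in> minimal_generators I" "a + c \<in> minimal_generators I"
    then have "a = a + c" unfolding minimal_generators_eq(1)[OF assms] by blast
    then show "c = 0" by simp
  qed
  show "I = ideal.span (monomial ` minimal_generators I)"
    unfolding minimal_generators_def by (rule conjunct1[OF theI'[OF minimal_generators_eq(2)[OF assms]]])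
qed

lemma monomial_in_iff_minimal_generators:
  fixes I :: "('n::finite, 'k::comm_ring_1) mpoly set"
  assumes "monomial_ideal I"
  shows "monomial a \<in> I \<longleftrightarrow> (\<exists>g\<in>minimal_generators I. \<exists>c. a = g + c)"
  using monomial_in_span_iff span_minimal_generators[OF assms] by metis

text \<open>In what follows, these symbols stand for the components and the inner product of \<open>real ^ 'n\<close>.\<close>

no_notation vec_index (infixl "$" 100) and scalar_prod (infix "\<bullet>" 70)

section \<open>Weights of exponent vectors\<close>

definition weight :: "real ^ 'n \<Rightarrow> 'n::finite expo \<Rightarrow> real" where
  "weight y a = y \<bullet> expo_vec a"

lemma weight_eq_sum: "weight y a = (\<Sum>i\<in>UNIV. y $ i * real (Poly_Mapping.lookup a i))"
  by (simp add: weight_def inner_vec_def expo_vec_def)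

lemma expo_vec_add: "expo_vec (a + b) = expo_vec a + expo_vec b"
  by (simp add: Finite_Cartesian_Product.vec_eq_iff expo_vec_def lookup_add)

lemma weight_add [simp]: "weight y (a + b) = weight y a + weight y b"
  by (simp add: weight_def expo_vec_add inner_add_right)

lemma weight_nonneg: "(\<And>i. 0 \<le> y $ i) \<Longrightarrow> 0 \<le> weight y a"
  by (simp add: weight_eq_sum sum_nonneg)

lemma upset_weight: "(\<And>i. 0 \<le> y $ i) \<Longrightarrow> upset {a. r \<le> weight y a}"
  by (auto simp: upset_def intro: add_increasing2 weight_nonneg)

lemma ideal_power_weight:
  assumes y: "\<And>i. 0 \<le> y $ i" and I: "I \<subseteq> supported_on {a. r \<le> weight y a}"
  shows "ideal_power I n \<subseteq> supported_on {a. real n * r \<le> weight y a}"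
proof (induction n)
  case 0
  show ?case using weight_nonneg[OF y] by (auto simp: supported_on_def)
next
  case (Suc n)
  show ?case unfolding ideal_power.simps
  proof (rule ideal_mult_least)
    fix f g assume "f \<in> I" "g \<in> ideal_power I n"
    then have "f \<in> supported_on {a. r \<le> weight y a}" "g \<in> supported_on {a. real n * r \<le> weight y a}"
      using I Suc by auto
    then show "f * g \<in> supported_on {a. real (Suc n) * r \<le> weight y a}"
      by (rule supported_on_mult) (auto simp: algebra_simps)
  qed (intro subspace_supported_on upset_weight y)
qed

lemma power_weight:
  fixes f :: "('n::finite, 'k::comm_ring_1) mpoly"
  assumes "\<And>i. 0 \<le> y $ i" "f \<in> supported_on {a. r \<le> weight y a}"
  shows "f ^ n \<in> supported_on {a. real n * r \<le> weight y a}"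
proof (induction n)
  case 0
  show ?case using weight_nonneg[of y] assms(1) by (auto simp: supported_on_def)
next
  case (Suc n)
  show ?case unfolding power_Suc
    by (rule supported_on_mult[OF assms(2) Suc]) (auto simp: algebra_simps)
qed

lemma split_support:
  obtains f0 f1 where "f = f0 + f1" "f0 \<in> supported_on (Poly_Mapping.keys f \<inter> U)"
    "f1 \<in> supported_on (Poly_Mapping.keys f - U)"
proof -
  define h where "h = (\<lambda>a. Poly_Mapping.single a (Poly_Mapping.lookup f a))"
  have h: "h a \<in> supported_on A" if "a \<in> A" for a A
    using that by (simp add: h_def supported_on_def)
  have "f = sum h (Poly_Mapping.keys f)" by (simp add: h_def sum_single_eq)
  also have "\<dots> = sum h (Poly_Mapping.keys f \<inter> U) + sum h (Poly_Mapping.keys f - U)"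
    by (rule sum.Int_Diff) simp
  finally show thesis by (rule that) (intro supported_on_sum h; assumption)+
qed

text \<open>The least weight of a term is additive on products, because the leading forms
  multiply to a nonzero polynomial.\<close>

lemma least_weight_mult:
  fixes f g :: "('n::{finite,linorder}, 'k::field) mpoly"
  assumes f: "f \<in> supported_on {a. r \<le> weight y a}" "f \<notin> supported_on {a. r < weight y a}"
    and g: "g \<in> supported_on {a. s \<le> weight y a}" "g \<notin> supported_on {a. s < weight y a}"
  shows "f * g \<notin> supported_on {a. r + s < weight y a}"
proof
  assume fg: "f * g \<in> supported_on {a. r + s < weight y a}"
  have split: "\<exists>f0 f1. f = f0 + f1 \<and> f0 \<noteq> 0 \<and> f0 \<in> supported_on {a. weight y a = r}
      \<and> f1 \<in> supported_on {a. r < weight y a}"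
    if f: "f \<in> supported_on {a. r \<le> weight y a}" "f \<notin> supported_on {a. r < weight y a}"
    for f :: "('n, 'k) mpoly" and r
  proof -
    obtain f0 f1 where s: "f = f0 + f1" "f0 \<in> supported_on (Poly_Mapping.keys f \<inter> {a. weight y a = r})"
      "f1 \<in> supported_on (Poly_Mapping.keys f - {a. weight y a = r})" by (rule split_support)
    have f1: "f1 \<in> supported_on {a. r < weight y a}"
      using s(3) f(1) by (force simp: supported_on_def)
    moreover have "f0 \<in> supported_on {a. weight y a = r}"
      using s(2) by (auto simp: supported_on_def)
    moreover have "f0 \<noteq> 0" using s(1) f(2) f1 by auto
    ultimately show ?thesis using s(1) by blast
  qed
  obtain f0 f1 where f': "f = f0 + f1" "f0 \<noteq> 0" "f0 \<in> supported_on {a. weight y a = r}"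
      "f1 \<in> supported_on {a. r < weight y a}" using split[OF f] by blast
  obtain g0 g1 where g': "g = g0 + g1" "g0 \<noteq> 0" "g0 \<in> supported_on {a. weight y a = s}"
      "g1 \<in> supported_on {a. s < weight y a}" using split[OF g] by blast
  have "f1 * g \<in> supported_on {a. r + s < weight y a}"
    by (rule supported_on_mult[OF f'(4) g(1)]) auto
  moreover have "f0 * g1 \<in> supported_on {a. r + s < weight y a}"
    by (rule supported_on_mult[OF f'(3) g'(4)]) auto
  moreover have "f0 * g0 = f * g - f1 * g - f0 * g1"
    by (simp add: f'(1) g'(1) algebra_simps)
  ultimately have "f0 * g0 \<in> supported_on {a. r + s < weight y a}"
    using fg by (simp add: supported_on_diff)
  moreover have "f0 * g0 \<in> supported_on {a. weight y a = r + s}"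
    by (rule supported_on_mult[OF f'(3) g'(3)]) auto
  ultimately have "Poly_Mapping.keys (f0 * g0) = {}" unfolding supported_on_def by fastforce
  then have "f0 * g0 = 0" using sum_single_eq[of "f0 * g0"] by simp
  with f'(2) g'(2) show False by simp
qed

lemma least_weight_power:
  fixes f :: "('n::{finite,linorder}, 'k::field) mpoly"
  assumes y: "\<And>i. 0 \<le> y $ i"
    and f: "f \<in> supported_on {a. r \<le> weight y a}" "f \<notin> supported_on {a. r < weight y a}"
  shows "f ^ n \<notin> supported_on {a. real n * r < weight y a}"
proof (induction n)
  case 0
  show ?case by (simp add: supported_on_def weight_def expo_vec_def inner_vec_def)
next
  case (Suc n)
  have "f * f ^ n \<notin> supported_on {a. r + real n * r < weight y a}"
    by (rule least_weight_mult[OF f power_weight[OF y f(1)] Suc])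
  then show ?case by (simp add: algebra_simps)
qed

text \<open>A lower bound for the weights in \<open>J\<close> also holds for the elements integral over \<open>J\<close>: if the
  least weight \<open>\<mu>\<close> in \<open>f\<close> were below \<open>r\<close>, then every term of an integral equation
  other than \<open>f\<^sup>m\<close> would only contain weights above \<open>m * \<mu>\<close>.\<close>

lemma integral_closure_weight:
  fixes J :: "('n::{finite,linorder}, 'k::field) mpoly set"
  assumes y: "\<And>i. 0 \<le> y $ i" and J: "J \<subseteq> supported_on {a. r \<le> weight y a}"
  shows "integral_closure J \<subseteq> supported_on {a. r \<le> weight y a}"
proof
  fix f assume "f \<in> integral_closure J"
  then obtain m b where m: "m \<ge> 1" "\<forall>i\<in>{1..m}. b i \<in> ideal_power J i"
    and eq: "f ^ m + (\<Sum>i=1..m. b i * f ^ (m - i)) = 0"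
    unfolding integral_closure_def by blast
  show "f \<in> supported_on {a. r \<le> weight y a}"
  proof (rule ccontr)
    assume "f \<notin> supported_on {a. r \<le> weight y a}"
    then obtain a where a: "a \<in> Poly_Mapping.keys f" "weight y a < r"
      by (force simp: supported_on_def)
    define \<mu> where "\<mu> = Min (weight y ` Poly_Mapping.keys f)"
    have "\<mu> \<le> weight y a" using a(1) by (simp add: \<mu>_def)
    with a(2) have \<mu>: "\<mu> < r" by simp
    have f1: "f \<in> supported_on {a. \<mu> \<le> weight y a}" by (auto simp: supported_on_def \<mu>_def)
    have "\<mu> \<in> weight y ` Poly_Mapping.keys f" unfolding \<mu>_def using a(1) by (intro Min_in) auto
    then have f2: "f \<notin> supported_on {a. \<mu> < weight y a}" by (force simp: supported_on_def)
    have "b i * f ^ (m - i) \<in> supported_on {a. real m * \<mu> < weight y a}" if i: "i \<in> {1..m}" for i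
    proof -
      have "b i \<in> supported_on {a. real i * r \<le> weight y a}"
        using m(2) i ideal_power_weight[OF y J, of i] by blast
      then show ?thesis
      proof (rule supported_on_mult[OF _ power_weight[OF y f1, of "m - i"]])
        fix c d assume "c \<in> {a. real i * r \<le> weight y a}" "d \<in> {a. real (m - i) * \<mu> \<le> weight y a}"
        then have "weight y (c + d) \<ge> real i * r + real (m - i) * \<mu>" by simp
        moreover have "real m * \<mu> = real i * \<mu> + real (m - i) * \<mu>"
          using i by (simp add: of_nat_diff algebra_simps)
        moreover have "real i * \<mu> < real i * r" using i \<mu> by simp
        ultimately show "c + d \<in> {a. real m * \<mu> < weight y a}" by simp
      qed
    qed
    then have "(\<Sum>i=1..m. b i * f ^ (m - i)) \<in> supported_on {a. real m * \<mu> < weight y a}"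
      by (rule supported_on_sum)
    moreover have "f ^ m = 0 - (\<Sum>i=1..m. b i * f ^ (m - i))" using eq by (simp add: eq_neg_iff_add_eq_0)
    ultimately have "f ^ m \<in> supported_on {a. real m * \<mu> < weight y a}"
      by (simp only:) (rule supported_on_diff, auto simp: supported_on_def)
    with least_weight_power[OF y f1 f2] show False by blast
  qed
qed

section \<open>Irreducible monomial ideals and their radicals\<close>

lemma var_power: "var i ^ k = (monomial (Poly_Mapping.single i k) :: ('n, 'k::comm_ring_1) mpoly)"
proof (induction k)
  case 0
  show ?case by (simp add: monomial_def)
next
  case (Suc k)
  then show ?case by (simp add: var_def monomial_mult single_add[symmetric])
qed

lemma q_ideal_eq_span:
  "(q_ideal b :: ('n, 'k::comm_ring_1) mpoly set) = ideal.span (monomial ` {Poly_Mapping.single i (Poly_Mapping.lookup b i) | i. i \<in> Poly_Mapping.keys b})"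
proof -
  have "{var i ^ Poly_Mapping.lookup b i | i. Poly_Mapping.lookup b i \<ge> 1}
      = (monomial ` {Poly_Mapping.single i (Poly_Mapping.lookup b i) | i. i \<in> Poly_Mapping.keys b}
          :: ('n, 'k) mpoly set)"
    by (auto simp: var_power in_keys_iff Suc_le_eq)
  then show ?thesis by (simp only: q_ideal_def)
qed

lemma monomial_ideal_q_ideal: "monomial_ideal (q_ideal b)"
  unfolding monomial_ideal_def q_ideal_eq_span by blast

lemma subspace_q_ideal [simp]: "ideal.subspace (q_ideal b)"
  by (simp add: subspace_monomial_ideal monomial_ideal_q_ideal)

lemma monomial_in_q_ideal_iff:
  "(monomial a :: ('n, 'k::comm_ring_1) mpoly) \<in> q_ideal b
    \<longleftrightarrow> (\<exists>i\<in>Poly_Mapping.keys b. Poly_Mapping.lookup b i \<le> Poly_Mapping.lookup a i)"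
proof -
  have "(\<exists>c. a = Poly_Mapping.single i k + c) \<longleftrightarrow> k \<le> Poly_Mapping.lookup a i" for i k
    unfolding expo_divides_iff by (auto simp: lookup_single when_def)
  then show ?thesis unfolding q_ideal_eq_span monomial_in_span_iff by blast
qed

lemma monomial_in_q_ideal_power:
  assumes "n \<le> (\<Sum>i\<in>UNIV. Poly_Mapping.lookup a i div Poly_Mapping.lookup (b :: 'n::finite expo) i)"
  shows "(monomial a :: ('n, 'k::comm_ring_1) mpoly) \<in> ideal_power (q_ideal b) n"
  using assms
proof (induction n arbitrary: a)
  case 0
  show ?case by simp
next
  case (Suc n)
  let ?s = "\<lambda>a. \<Sum>i\<in>UNIV. Poly_Mapping.lookup a i div Poly_Mapping.lookup b i"
  have "?s a \<noteq> 0" using Suc.prems by linarith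
  then obtain i where i: "Poly_Mapping.lookup a i div Poly_Mapping.lookup b i \<noteq> 0"
    by (rule sum.not_neutral_contains_not_neutral)
  then have b: "i \<in> Poly_Mapping.keys b" and le: "Poly_Mapping.lookup b i \<le> Poly_Mapping.lookup a i"
    by (auto simp: in_keys_iff div_eq_0_iff not_less intro: ccontr)
  define e where "e = Poly_Mapping.single i (Poly_Mapping.lookup b i)"
  have "\<forall>k. Poly_Mapping.lookup e k \<le> Poly_Mapping.lookup a k"
    using le by (auto simp: e_def lookup_single when_def)
  then obtain c where c: "a = e + c" unfolding expo_divides_iff[symmetric] by blast
  have "?s a = ?s c + (\<Sum>k\<in>UNIV. if i = k then 1 else 0)"
    unfolding sum.distrib[symmetric]
    by (intro sum.cong) (use b in \<open>auto simp: c e_def lookup_add lookup_single when_def in_keys_iff div_add_self1\<close>)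
  then have "n \<le> ?s c" using Suc.prems by simp
  moreover have "(monomial e :: ('n, 'k) mpoly) \<in> q_ideal b"
    unfolding monomial_in_q_ideal_iff using b by (intro bexI[of _ i]) (simp_all add: e_def)
  ultimately have "(monomial e * monomial c :: ('n, 'k) mpoly) \<in> ideal_power (q_ideal b) (Suc n)"
    unfolding ideal_power.simps by (intro ideal_mult_memI Suc.IH)
  then show ?case by (simp add: monomial_mult c)
qed

text \<open>The prime ideal generated by the variables in a set.\<close>

definition var_prime :: "'n set \<Rightarrow> ('n, 'k::comm_ring_1) mpoly set" where
  "var_prime A = supported_on {a. \<exists>i\<in>A. Poly_Mapping.lookup a i \<noteq> 0}"

definition char_vec :: "'n::finite set \<Rightarrow> real ^ 'n" where
  "char_vec A = (\<chi> i. if i \<in> A then 1 else 0)"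

lemma char_vec_nonneg: "0 \<le> char_vec A $ i"
  by (simp add: char_vec_def)

lemma weight_char_vec: "weight (char_vec A) a = real (\<Sum>i\<in>A. Poly_Mapping.lookup a i)"
  by (simp add: weight_eq_sum char_vec_def if_distrib[of "\<lambda>x. x * _"] sum.If_cases cong: if_cong)

lemma var_prime_eq_weight: "var_prime A = supported_on {a. 0 < weight (char_vec A) a}"
proof -
  have "0 < weight (char_vec A) a \<longleftrightarrow> (\<exists>i\<in>A. Poly_Mapping.lookup a i \<noteq> 0)" for a
  proof -
    have "0 < weight (char_vec A) a \<longleftrightarrow> (\<Sum>i\<in>A. Poly_Mapping.lookup a i) \<noteq> 0"
      unfolding weight_char_vec by linarith
    then show ?thesis by simp
  qed
  then have "{a. \<exists>i\<in>A. Poly_Mapping.lookup a i \<noteq> 0} = {a. 0 < weight (char_vec A) a}"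
    by (simp only:)
  then show ?thesis by (simp only: var_prime_def)
qed

text \<open>For the weight that counts the variables in \<open>A\<close>, a polynomial lies outside the ideal exactly if its least
  weight is \<open>0\<close>, and least weights add up on products.\<close>

lemma prime_ideal_var_prime:
  "prime_ideal (var_prime A :: ('n::{finite,linorder}, 'k::field) mpoly set)"
  unfolding prime_ideal_def
proof (intro conjI allI impI)
  show "ideal.subspace (var_prime A :: ('n, 'k) mpoly set)"
    unfolding var_prime_def by (rule subspace_supported_on) (auto simp: upset_def lookup_add)
  have "(monomial 0 :: ('n, 'k) mpoly) \<notin> var_prime A" by (simp add: var_prime_def)
  then show "(var_prime A :: ('n, 'k) mpoly set) \<noteq> UNIV" by blast
  fix f g :: "('n, 'k) mpoly" assume fg: "f * g \<in> var_prime A"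
  have "h \<in> supported_on {a. 0 \<le> weight (char_vec A) a}" for h :: "('n, 'k) mpoly"
    using weight_nonneg[OF char_vec_nonneg] by (auto simp: supported_on_def)
  then show "f \<in> var_prime A \<or> g \<in> var_prime A"
    using least_weight_mult[of f 0 "char_vec A" g 0] fg unfolding var_prime_eq_weight by auto
qed

lemma q_ideal_subset_var_prime:
  "(q_ideal b :: ('n, 'k::comm_ring_1) mpoly set) \<subseteq> var_prime (Poly_Mapping.keys b)"
proof
  fix f :: "('n, 'k) mpoly" assume "f \<in> q_ideal b"
  then have "\<forall>a\<in>Poly_Mapping.keys f. (monomial a :: ('n, 'k) mpoly) \<in> q_ideal b"
    using monomial_ideal_mem_iff[OF monomial_ideal_q_ideal] by blast
  then have "\<forall>a\<in>Poly_Mapping.keys f. \<exists>i\<in>Poly_Mapping.keys b. Poly_Mapping.lookup a i \<noteq> 0"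
    unfolding monomial_in_q_ideal_iff by (metis in_keys_iff le_zero_eq)
  then show "f \<in> var_prime (Poly_Mapping.keys b)"
    unfolding var_prime_def supported_on_def by blast
qed

lemma var_prime_subset_prime:
  fixes P :: "('n, 'k::comm_ring_1) mpoly set"
  assumes P: "prime_ideal P" and q: "q_ideal b \<subseteq> P"
  shows "var_prime (Poly_Mapping.keys b) \<subseteq> P"
proof
  have sub: "ideal.subspace P" using P by (simp add: prime_ideal_def)
  have one: "1 \<notin> P"
  proof
    assume "1 \<in> P"
    then have "x \<in> P" for x using ideal.subspace_scale[OF sub, of 1 x] by simp
    then show False using P by (auto simp: prime_ideal_def)
  qed
  have root: "x \<in> P" if "x ^ n \<in> P" for x n
    using that
  proof (induction n)
    case (Suc n)
    then show ?case using P by (auto simp: prime_ideal_def)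
  qed (use one in simp)
  have var: "var i \<in> P" if "i \<in> Poly_Mapping.keys b" for i
  proof -
    have "(monomial (Poly_Mapping.single i (Poly_Mapping.lookup b i)) :: ('n, 'k) mpoly) \<in> q_ideal b"
      unfolding monomial_in_q_ideal_iff using that by (intro bexI[of _ i]) simp_all
    then show ?thesis using q root by (auto simp flip: var_power)
  qed
  fix f :: "('n, 'k) mpoly" assume f: "f \<in> var_prime (Poly_Mapping.keys b)"
  have "(\<Sum>a\<in>Poly_Mapping.keys f. Poly_Mapping.single a (Poly_Mapping.lookup f a)) \<in> P"
  proof (rule ideal.subspace_sum[OF sub])
    fix a assume "a \<in> Poly_Mapping.keys f"
    with f obtain i where i: "i \<in> Poly_Mapping.keys b" "Poly_Mapping.lookup a i \<noteq> 0"
      by (auto simp: var_prime_def supported_on_def)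
    then have "\<forall>k. Poly_Mapping.lookup (Poly_Mapping.single i (1::nat)) k \<le> Poly_Mapping.lookup a k"
      by (auto simp: lookup_single when_def)
    then obtain c where "a = Poly_Mapping.single i 1 + c" unfolding expo_divides_iff[symmetric] by blast
    then have "Poly_Mapping.single a (Poly_Mapping.lookup f a)
        = Poly_Mapping.single c (Poly_Mapping.lookup f a) * var i"
      by (simp add: var_def monomial_def mult_single add.commute)
    then show "Poly_Mapping.single a (Poly_Mapping.lookup f a) \<in> P"
      using ideal.subspace_scale[OF sub var[OF i(1)]] by simp
  qed
  then show "f \<in> P" by (simp add: sum_single_eq)
qed

text \<open>Every term of a polynomial in the prime ideal contains a variable in the support of \<open>b\<close>, so a
  power with an exponent above the sum of the entries of \<open>b\<close> only has terms in which one of these variables reaches the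
  exponent prescribed by \<open>b\<close>.\<close>

lemma radical_q_ideal:
  "radical (q_ideal b :: ('n::{finite,linorder}, 'k::field) mpoly set) = var_prime (Poly_Mapping.keys b)"
proof
  show "radical (q_ideal b :: ('n, 'k) mpoly set) \<subseteq> var_prime (Poly_Mapping.keys b)"
  proof
    fix f :: "('n, 'k) mpoly" assume "f \<in> radical (q_ideal b)"
    then obtain n where "f ^ n \<in> q_ideal b" by (auto simp: radical_def)
    then have "f ^ n \<in> var_prime (Poly_Mapping.keys b)" using q_ideal_subset_var_prime by blast
    then show "f \<in> var_prime (Poly_Mapping.keys b)"
    proof (induction n)
      case 0
      then show ?case by (simp add: var_prime_def supported_on_def)
    next
      case (Suc n)
      then show ?case using prime_ideal_var_prime unfolding prime_ideal_def by (metis power_Suc)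
    qed
  qed
  show "var_prime (Poly_Mapping.keys b) \<subseteq> radical (q_ideal b :: ('n, 'k) mpoly set)"
  proof
    fix f :: "('n, 'k) mpoly" assume f: "f \<in> var_prime (Poly_Mapping.keys b)"
    let ?A = "Poly_Mapping.keys b"
    define n where "n = Suc (\<Sum>i\<in>?A. Poly_Mapping.lookup b i)"
    have "f \<in> supported_on {a. 1 \<le> weight (char_vec ?A) a}"
      using f unfolding var_prime_eq_weight
      by (auto simp: supported_on_def weight_char_vec Suc_le_eq simp del: of_nat_sum)
    then have fn: "f ^ n \<in> supported_on {a. real n * 1 \<le> weight (char_vec ?A) a}"
      by (rule power_weight[OF char_vec_nonneg])
    have "(monomial a :: ('n, 'k) mpoly) \<in> q_ideal b" if "a \<in> Poly_Mapping.keys (f ^ n)" for a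
    proof (rule ccontr)
      assume "(monomial a :: ('n, 'k) mpoly) \<notin> q_ideal b"
      then have "(\<Sum>i\<in>?A. Poly_Mapping.lookup a i) \<le> (\<Sum>i\<in>?A. Poly_Mapping.lookup b i)"
        unfolding monomial_in_q_ideal_iff by (intro sum_mono) auto
      moreover have "n \<le> (\<Sum>i\<in>?A. Poly_Mapping.lookup a i)"
        using that fn by (auto simp: supported_on_def weight_char_vec simp del: of_nat_sum)
      ultimately show False by (simp add: n_def)
    qed
    then have "f ^ n \<in> q_ideal b" using monomial_ideal_mem_iff[OF monomial_ideal_q_ideal] by blast
    then show "f \<in> radical (q_ideal b)" unfolding radical_def n_def by force
  qed
qed

section \<open>Symbolic powers of an intersection of irreducible monomial ideals\<close>

lemma prime_ideal_supset_Inter: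
  fixes Q :: "'m::finite \<Rightarrow> 'a::comm_ring_1 set"
  assumes P: "prime_ideal P" "(\<Inter>j. Q j) \<subseteq> P" and Q: "\<And>j. ideal.subspace (Q j)"
  obtains j where "Q j \<subseteq> P"
proof (rule ccontr)
  assume "\<not> thesis"
  with that have "\<forall>j. \<exists>x. x \<in> Q j \<and> x \<notin> P" by blast
  then obtain x where x: "\<And>j. x j \<in> Q j" "\<And>j. x j \<notin> P" by metis
  have one: "1 \<notin> P"
  proof
    assume "1 \<in> P"
    then have "y \<in> P" for y using ideal.subspace_scale[of P 1 y] P(1) by (simp add: prime_ideal_def)
    then show False using P(1) by (auto simp: prime_ideal_def)
  qed
  have "prod x A \<notin> P" for A :: "'m set"
  proof (induction A rule: finite_induct[OF finite])
    case (2 j A)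
    then show ?case using P(1) x(2) by (auto simp: prime_ideal_def)
  qed (use one in simp)
  moreover have "prod x UNIV \<in> Q j" for j
    using ideal.subspace_scale[OF Q x(1), of "prod x (UNIV - {j})" j]
    by (simp add: prod.remove[of UNIV j] mult.commute)
  ultimately show False using P(2) by blast
qed

lemma minimal_primes_Inter_q_ideal:
  fixes \<alpha> :: "'m::finite \<Rightarrow> 'n::{finite,linorder} expo"
  assumes "P \<in> minimal_primes (\<Inter>j. q_ideal (\<alpha> j) :: ('n, 'k::field) mpoly set)"
  obtains k where "P = var_prime (Poly_Mapping.keys (\<alpha> k))"
proof -
  let ?I = "\<Inter>j. q_ideal (\<alpha> j) :: ('n, 'k) mpoly set"
  have P: "prime_ideal P" "?I \<subseteq> P"
    and min: "\<And>P'. prime_ideal P' \<Longrightarrow> ?I \<subseteq> P' \<Longrightarrow> P' \<subseteq> P \<Longrightarrow> P' = P"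
    using assms by (auto simp: minimal_primes_def)
  obtain k where "q_ideal (\<alpha> k) \<subseteq> P" using prime_ideal_supset_Inter[OF P] subspace_q_ideal by metis
  then have "var_prime (Poly_Mapping.keys (\<alpha> k)) \<subseteq> P" by (rule var_prime_subset_prime[OF P(1)])
  moreover have "?I \<subseteq> var_prime (Poly_Mapping.keys (\<alpha> k))"
    using q_ideal_subset_var_prime by blast
  ultimately show thesis using min prime_ideal_var_prime that by metis
qed

text \<open>Outside the prime \<open>P\<close>, the multiplier \<open>h\<close> becomes invertible: \<open>x = (1 / h) * (h * x)\<close> in the
  localization at \<open>P\<close>.\<close>

lemma subset_symbolic_power:
  assumes "\<And>P. P \<in> minimal_primes I \<Longrightarrow> \<exists>h. h \<notin> P \<and> (\<forall>x\<in>X. h * x \<in> ideal_power I n)"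
  shows "X \<subseteq> symbolic_power I n"
  unfolding symbolic_power_def
proof (intro subsetI INT_I CollectI)
  fix x P assume x: "x \<in> X" and P: "P \<in> minimal_primes I"
  then obtain h where h: "h \<notin> P" "h * x \<in> ideal_power I n" using assms by blast
  have "0 \<in> P" using P by (auto simp: minimal_primes_def prime_ideal_def intro: ideal.subspace_0)
  with h have "h \<noteq> 0" by blast
  then have "Fract x 1 = (\<Sum>y\<in>{h * x}. Fract 1 h * Fract y 1)" by (simp add: eq_fract)
  moreover have "Fract 1 h \<in> localization_at P" using h by (auto simp: localization_at_def)
  ultimately show "Fract x 1 \<in> localized_ideal (ideal_power I n) P"
    unfolding localized_ideal_def using h(2) 
    by (intro CollectI exI[of _ "{h * x}"] exI[of _ "\<lambda>_. Fract 1 h"]) simp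
qed

lemma power_mult_ideal_power:
  assumes "\<And>x. x \<in> Q \<Longrightarrow> h * x \<in> I" "y \<in> ideal_power Q n"
  shows "h ^ n * y \<in> ideal_power (I :: 'a::comm_ring_1 set) n"
  using assms(2)
proof (induction n arbitrary: y)
  case 0
  show ?case by simp
next
  case (Suc n)
  have "ideal_mult Q (ideal_power Q n) \<subseteq> {y. h ^ Suc n * y \<in> ideal_power I (Suc n)}"
  proof (rule ideal_mult_least)
    show "ideal.subspace {y. h ^ Suc n * y \<in> ideal_power I (Suc n)}"
      unfolding ideal.subspace_def
    proof (intro conjI ballI allI)
      fix r y assume "y \<in> {y. h ^ Suc n * y \<in> ideal_power I (Suc n)}"
      then have "h ^ Suc n * y \<in> ideal_power I (Suc n)" by (rule CollectD)
      then have "r * (h ^ Suc n * y) \<in> ideal_power I (Suc n)"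
        by (rule ideal.subspace_scale[OF subspace_ideal_power])
      then show "r * y \<in> {y. h ^ Suc n * y \<in> ideal_power I (Suc n)}" by (simp only: mult.left_commute mem_Collect_eq)
    qed (auto simp: distrib_left simp del: ideal_power.simps power_Suc
        intro: ideal.subspace_0 ideal.subspace_add[OF subspace_ideal_power])
    fix x y assume "x \<in> Q" "y \<in> ideal_power Q n"
    then have "(h * x) * (h ^ n * y) \<in> ideal_power I (Suc n)"
      unfolding ideal_power.simps by (intro ideal_mult_memI assms(1) Suc.IH)
    moreover have "(h * x) * (h ^ n * y) = h ^ Suc n * (x * y)" by (simp add: mult_ac)
    ultimately show "x * y \<in> {y. h ^ Suc n * y \<in> ideal_power I (Suc n)}" by simp
  qed
  with Suc.prems show ?case unfolding ideal_power.simps by blast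
qed

text \<open>If no other component has its support inside that of \<open>\<alpha> k\<close>, then each of them
  contains a pure power of a variable outside this support. The product of these powers carries
  the component \<open>k\<close> into the intersection, and it is a unit in the localization at the radical.\<close>

lemma multiplier_into_Inter_q_ideal:
  fixes \<alpha> :: "'m::finite \<Rightarrow> 'n expo"
  assumes inc: "\<And>j. j \<noteq> k \<Longrightarrow> \<not> Poly_Mapping.keys (\<alpha> j) \<subseteq> Poly_Mapping.keys (\<alpha> k)"
  obtains a where "\<And>i. i \<in> Poly_Mapping.keys (\<alpha> k) \<Longrightarrow> Poly_Mapping.lookup a i = 0"
    "\<And>x. x \<in> q_ideal (\<alpha> k) \<Longrightarrow> monomial a * x \<in> (\<Inter>j. q_ideal (\<alpha> j) :: ('n, 'k::comm_ring_1) mpoly set)"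
proof -
  have "\<forall>j. \<exists>i. j \<noteq> k \<longrightarrow> i \<in> Poly_Mapping.keys (\<alpha> j) - Poly_Mapping.keys (\<alpha> k)" using inc by blast
  then obtain i where i: "\<And>j. j \<noteq> k \<Longrightarrow> i j \<in> Poly_Mapping.keys (\<alpha> j) - Poly_Mapping.keys (\<alpha> k)" by metis
  define a where "a = (\<Sum>j\<in>UNIV - {k}. Poly_Mapping.single (i j) (Poly_Mapping.lookup (\<alpha> j) (i j)))"
  show thesis
  proof (rule that[of a])
    fix l assume "l \<in> Poly_Mapping.keys (\<alpha> k)"
    then show "Poly_Mapping.lookup a l = 0"
      using i by (auto simp: a_def lookup_sum lookup_single when_def)
  next
    fix x :: "('n, 'k) mpoly" assume x: "x \<in> q_ideal (\<alpha> k)"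
    have "monomial a * x \<in> q_ideal (\<alpha> j)" for j
    proof (cases "j = k")
      case True
      then show ?thesis using ideal.subspace_scale[OF subspace_q_ideal x] by simp
    next
      case False
      have "Poly_Mapping.lookup (\<alpha> j) (i j) \<le> (\<Sum>l\<in>UNIV - {k}. Poly_Mapping.lookup (\<alpha> l) (i l) when i l = i j)"
        using member_le_sum[of j "UNIV - {k}" "\<lambda>l. Poly_Mapping.lookup (\<alpha> l) (i l) when i l = i j"] False by simp
      then have "Poly_Mapping.lookup (\<alpha> j) (i j) \<le> Poly_Mapping.lookup a (i j)"
        by (simp add: a_def lookup_sum lookup_single)
      then have "(monomial a :: ('n, 'k) mpoly) \<in> q_ideal (\<alpha> j)"
        unfolding monomial_in_q_ideal_iff using i[OF False] by blast
      from ideal.subspace_scale[OF subspace_q_ideal this, of x] show ?thesis by (simp add: mult.commute)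
    qed
    then show "monomial a * x \<in> (\<Inter>j. q_ideal (\<alpha> j))" by blast
  qed
qed

lemma supports_incomparable:
  fixes \<alpha> :: "'m \<Rightarrow> 'n::{finite,linorder} expo"
  defines "I \<equiv> (\<Inter>j. q_ideal (\<alpha> j) :: ('n, 'k::field) mpoly set)"
  assumes inj: "inj (\<lambda>j. Poly_Mapping.keys (\<alpha> j))"
    and P: "var_prime (Poly_Mapping.keys (\<alpha> k)) \<in> minimal_primes I" and "j \<noteq> k"
  shows "\<not> Poly_Mapping.keys (\<alpha> j) \<subseteq> Poly_Mapping.keys (\<alpha> k)"
proof
  assume sub: "Poly_Mapping.keys (\<alpha> j) \<subseteq> Poly_Mapping.keys (\<alpha> k)"
  then have "(var_prime (Poly_Mapping.keys (\<alpha> j)) :: ('n, 'k) mpoly set) \<subseteq> var_prime (Poly_Mapping.keys (\<alpha> k))"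
    unfolding var_prime_def by (intro supported_on_mono) auto
  moreover have "I \<subseteq> var_prime (Poly_Mapping.keys (\<alpha> j))"
    unfolding I_def using q_ideal_subset_var_prime by blast
  ultimately have eq: "(var_prime (Poly_Mapping.keys (\<alpha> j)) :: ('n, 'k) mpoly set) = var_prime (Poly_Mapping.keys (\<alpha> k))"
    using P prime_ideal_var_prime unfolding minimal_primes_def by blast
  have "i \<in> Poly_Mapping.keys (\<alpha> j)" if "i \<in> Poly_Mapping.keys (\<alpha> k)" for i
  proof -
    have "(var i :: ('n, 'k) mpoly) \<in> var_prime A \<longleftrightarrow> i \<in> A" for A
      by (auto simp: var_prime_def var_def lookup_single when_def)
    then show ?thesis using eq that by blast
  qed
  with sub have "Poly_Mapping.keys (\<alpha> j) = Poly_Mapping.keys (\<alpha> k)" by blast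
  with inj \<open>j \<noteq> k\<close> show False by (auto simp: inj_def)
qed

lemma component_multiplier:
  fixes \<alpha> :: "'m::finite \<Rightarrow> 'n::{finite,linorder} expo"
  defines "I \<equiv> (\<Inter>j. q_ideal (\<alpha> j) :: ('n, 'k::field) mpoly set)"
  assumes inj: "inj (\<lambda>j. Poly_Mapping.keys (\<alpha> j))"
    and P: "var_prime (Poly_Mapping.keys (\<alpha> k)) \<in> minimal_primes I"
  obtains h where "h \<notin> var_prime (Poly_Mapping.keys (\<alpha> k))"
    "\<And>x n. x \<in> ideal_power (q_ideal (\<alpha> k)) n \<Longrightarrow> h ^ n * x \<in> ideal_power I n"
proof -
  note inc = supports_incomparable[OF inj P[unfolded I_def]]
  obtain a where a: "\<And>i. i \<in> Poly_Mapping.keys (\<alpha> k) \<Longrightarrow> Poly_Mapping.lookup a i = 0"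
    "\<And>x :: ('n, 'k) mpoly. x \<in> q_ideal (\<alpha> k) \<Longrightarrow> monomial a * x \<in> I"
    using multiplier_into_Inter_q_ideal[of k \<alpha>, OF inc] unfolding I_def by metis
  show thesis
  proof (rule that)
    show "(monomial a :: ('n, 'k) mpoly) \<notin> var_prime (Poly_Mapping.keys (\<alpha> k))"
      using a(1) by (auto simp: var_prime_def)
  qed (rule power_mult_ideal_power[OF a(2)])
qed

text \<open>Only the components with minimal radical are localized, so the intersection may be restricted to
  any set \<open>J\<close> of components that includes these. All components will be taken for the powers of the ideal, and
  all but one to exclude embedded components.\<close>

lemma Inter_power_subset_symbolic_power:
  fixes \<alpha> :: "'m::finite \<Rightarrow> 'n::{finite,linorder} expo"
  defines "I \<equiv> (\<Inter>j. q_ideal (\<alpha> j) :: ('n, 'k::field) mpoly set)"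
  assumes inj: "inj (\<lambda>j. Poly_Mapping.keys (\<alpha> j))"
    and J: "\<And>k. var_prime (Poly_Mapping.keys (\<alpha> k)) \<in> minimal_primes I \<Longrightarrow> k \<in> J"
  shows "(\<Inter>j\<in>J. ideal_power (q_ideal (\<alpha> j)) n) \<subseteq> symbolic_power I n"
proof (rule subset_symbolic_power)
  fix P assume P: "P \<in> minimal_primes I"
  then obtain k where k: "P = var_prime (Poly_Mapping.keys (\<alpha> k))"
    unfolding I_def using minimal_primes_Inter_q_ideal by blast
  obtain h where h: "h \<notin> P" "\<And>x n. x \<in> ideal_power (q_ideal (\<alpha> k)) n \<Longrightarrow> h ^ n * x \<in> ideal_power I n"
    using component_multiplier[OF inj, of k] P unfolding k I_def by metis
  have "1 \<notin> P" unfolding k by (simp add: var_prime_def supported_on_def)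
  have "h ^ n \<notin> P"
  proof (induction n)
    case (Suc n)
    then show ?case using h(1) P by (auto simp: minimal_primes_def prime_ideal_def)
  qed (use \<open>1 \<notin> P\<close> in simp)
  moreover have "k \<in> J" using J P unfolding k by blast
  ultimately show "\<exists>h. h \<notin> P \<and> (\<forall>x\<in>\<Inter>j\<in>J. ideal_power (q_ideal (\<alpha> j)) n. h * x \<in> ideal_power I n)"
    using h(2) by blast
qed

text \<open>If the first symbolic power of an irredundant intersection is the intersection itself, then
  it has no embedded component: a component whose radical is not minimal could be omitted.\<close>

lemma no_embedded_component:
  fixes \<alpha> :: "'m::finite \<Rightarrow> 'n::{finite,linorder} expo"
  defines "I \<equiv> (\<Inter>j. q_ideal (\<alpha> j) :: ('n, 'k::field) mpoly set)"
  assumes inj: "inj (\<lambda>j. Poly_Mapping.keys (\<alpha> j))"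
    and irredundant: "I \<noteq> (\<Inter>i\<in>UNIV - {j}. q_ideal (\<alpha> i))"
    and sym: "symbolic_power I 1 \<subseteq> I"
  shows "var_prime (Poly_Mapping.keys (\<alpha> j)) \<in> minimal_primes I"
proof (rule ccontr)
  assume "var_prime (Poly_Mapping.keys (\<alpha> j)) \<notin> minimal_primes I"
  then have "(\<Inter>i\<in>UNIV - {j}. ideal_power (q_ideal (\<alpha> i)) 1) \<subseteq> symbolic_power I 1"
    unfolding I_def by (intro Inter_power_subset_symbolic_power inj) auto
  also note sym
  finally have "(\<Inter>i\<in>UNIV - {j}. q_ideal (\<alpha> i)) \<subseteq> I" by (simp only: ideal_power_1[OF subspace_q_ideal])
  moreover have "I \<subseteq> (\<Inter>i\<in>UNIV - {j}. q_ideal (\<alpha> i))" by (auto simp: I_def)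
  ultimately show False using irredundant by blast
qed

section \<open>Dominants of finite point sets\<close>

text \<open>The Newton polyhedron is the dominant of the exponent vectors of the generators, and the
  covering polyhedron will turn out to be the dominant of the points \<open>inv_vec (\<alpha> j)\<close>.\<close>

definition dominant :: "(real ^ 'n) set \<Rightarrow> (real ^ 'n) set" where
  "dominant C = {x + y | x y. (\<forall>i. 0 \<le> x $ i) \<and> y \<in> convex hull C}"

lemma newton_polyhedron_eq_dominant:
  "newton_polyhedron I = dominant (expo_vec ` minimal_generators I)"
  by (simp add: newton_polyhedron_def dominant_def)

lemma nonneg_inner_nonneg:
  fixes x y :: "real ^ 'n"
  assumes "\<forall>i. 0 \<le> x $ i" "\<forall>i. 0 \<le> y $ i"
  shows "0 \<le> x \<bullet> y"
  using assms by (simp add: inner_vec_def sum_nonneg)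

lemma inner_hull_ge:
  assumes "\<forall>c\<in>C. b \<le> y \<bullet> c" "x \<in> convex hull C"
  shows "b \<le> y \<bullet> x"
proof -
  have "convex hull C \<subseteq> {x. y \<bullet> x \<ge> b}"
    using assms(1) by (intro hull_minimal) (auto simp: convex_halfspace_ge)
  with assms(2) show ?thesis by auto
qed

lemma inner_dominant_ge:
  assumes y: "\<forall>i. 0 \<le> y $ i" and "\<forall>c\<in>C. b \<le> y \<bullet> c" "x \<in> dominant C"
  shows "b \<le> y \<bullet> x"
proof -
  obtain r z where x: "x = r + z" "\<forall>i. 0 \<le> r $ i" "z \<in> convex hull C"
    using assms(3) by (auto simp: dominant_def)
  then show ?thesis
    using inner_hull_ge[OF assms(2) x(3)] nonneg_inner_nonneg[OF y x(2)] by (simp add: inner_add_right)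
qed

lemma dominant_nonneg:
  assumes "\<forall>c\<in>C. \<forall>i. 0 \<le> c $ i" "x \<in> dominant C"
  shows "0 \<le> x $ i"
proof -
  have "0 \<le> axis i 1 \<bullet> x"
    using assms(1) by (intro inner_dominant_ge[OF _ _ assms(2)]) (simp add: axis_def, simp add: inner_axis')
  then show ?thesis by (simp add: inner_axis')
qed

text \<open>A dominant is closed, convex and closed under increasing coordinates. Therefore a point
  outside is cut off by a hyperplane, and its normal vector has no negative coordinate.\<close>

lemma dominant_separation:
  fixes C :: "(real ^ 'n) set"
  assumes C: "finite C" "C \<noteq> {}" and z: "z \<notin> dominant C"
  obtains y b where "\<forall>i. 0 \<le> y $ i" "y \<bullet> z < b" "\<forall>c\<in>C. b \<le> y \<bullet> c"
proof -
  let ?O = "{x :: real ^ 'n. \<forall>i. 0 \<le> x $ i}"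
  have O: "closed ?O" "convex ?O"
    by (auto simp: Collect_all_eq closed_halfspace_component_ge_cart convex_def intro!: closed_INT)
  have eq: "dominant C = (\<Union>x\<in>?O. \<Union>y\<in>convex hull C. {x + y})"
    by (auto simp: dominant_def)
  have "closed (dominant C)"
    unfolding eq by (intro closed_compact_sums O finite_imp_compact_convex_hull C)
  moreover have "convex (dominant C)"
    unfolding eq by (intro convex_sums O convex_convex_hull)
  ultimately obtain y b where y: "y \<bullet> z < b" "\<forall>x\<in>dominant C. b < y \<bullet> x"
    using separating_hyperplane_closed_point z by blast
  have in_dom: "r + c \<in> dominant C" if "\<forall>i. 0 \<le> r $ i" "c \<in> C" for r c
    using that hull_inc[of c C convex] by (auto simp: dominant_def)
  obtain c where c: "c \<in> C" using C by blast
  have "0 \<le> y $ i" for i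
  proof (rule ccontr)
    assume neg: "\<not> 0 \<le> y $ i"
    (* Going far enough in direction i makes the linear form fall below b. *)
    define t where "t = max 0 ((b - y \<bullet> c) / y $ i)"
    have "(t *\<^sub>R axis i 1 :: real ^ 'n) $ k \<ge> 0" for k by (simp add: t_def axis_def)
    then have "b < y \<bullet> (t *\<^sub>R axis i 1 + c)" using y(2) in_dom[OF _ c] by blast
    also have "\<dots> = t * y $ i + y \<bullet> c" by (simp add: inner_add_right inner_axis)
    also have "t * y $ i \<le> (b - y \<bullet> c) / y $ i * y $ i"
      using neg by (intro mult_right_mono_neg) (auto simp: t_def)
    finally show False using neg by simp
  qed
  moreover have "\<forall>c\<in>C. b \<le> y \<bullet> c" using y(2) in_dom[of 0] by fastforce
  ultimately show thesis using that y(1) by blast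
qed

text \<open>Blocking duality: if the dominant of \<open>C\<close> contains the covering polyhedron of \<open>E\<close>, then
  conversely the dominant of \<open>E\<close> contains the covering polyhedron of \<open>C\<close>. A linear form that separates
  a point from the dominant of \<open>E\<close> becomes, when scaled, a point of the covering polyhedron of \<open>E\<close>.\<close>

lemma blocking_duality:
  fixes C E :: "(real ^ 'n) set"
  assumes E: "finite E" "E \<noteq> {}" and sub: "Q_polyhedron E \<subseteq> dominant C"
  shows "Q_polyhedron C \<subseteq> dominant E"
proof
  fix x assume x: "x \<in> Q_polyhedron C"
  then have x0: "\<forall>i. 0 \<le> x $ i" by (simp add: Q_polyhedron_def)
  show "x \<in> dominant E"
  proof (rule ccontr)
    assume "x \<notin> dominant E"
    then obtain y b where y: "\<forall>i. 0 \<le> y $ i" "y \<bullet> x < b" "\<forall>e\<in>E. b \<le> y \<bullet> e"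
      using dominant_separation[OF E] by blast
    with nonneg_inner_nonneg[OF y(1) x0] have b: "b > 0" by simp
    have "(1 / b) *\<^sub>R y \<in> Q_polyhedron E"
      using y b by (simp add: Q_polyhedron_def field_simps)
    with sub have "1 \<le> x \<bullet> ((1 / b) *\<^sub>R y)"
      using x by (intro inner_dominant_ge[OF x0, of C]) (auto simp: Q_polyhedron_def)
    with y(2) b show False by (simp add: inner_commute field_simps)
  qed
qed

lemma convex_Q_polyhedron: "convex (Q_polyhedron C)"
proof -
  have "Q_polyhedron C = (\<Inter>i. {x. 0 \<le> x $ i}) \<inter> (\<Inter>c\<in>C. {x. c \<bullet> x \<ge> 1})"
    by (auto simp: Q_polyhedron_def inner_commute)
  moreover have "convex {x :: real ^ 'a. 0 \<le> x $ i}" for i by (auto simp: convex_def)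
  ultimately show ?thesis
    by (simp only:) (intro convex_Int convex_INT convex_halfspace_ge)
qed

text \<open>A vertex of a covering polyhedron cannot lie strictly above another of its points, so it is
  one of the points that generate a dominant containing the polyhedron.\<close>

lemma vertices_Q_polyhedron_subset:
  fixes C E :: "(real ^ 'n) set"
  assumes C: "\<forall>c\<in>C. \<forall>i. 0 \<le> c $ i"
    and sub: "Q_polyhedron C \<subseteq> dominant E" and E: "E \<subseteq> Q_polyhedron C"
  shows "vertices (Q_polyhedron C) \<subseteq> E"
proof
  fix x assume "x \<in> vertices (Q_polyhedron C)"
  then have x: "x extreme_point_of Q_polyhedron C" by (simp add: vertices_def)
  then have "x \<in> dominant E" using sub by (auto simp: extreme_point_of_def)
  then obtain r z where r: "x = r + z" "\<forall>i. 0 \<le> r $ i" "z \<in> convex hull E"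
    by (auto simp: dominant_def)
  have hull: "convex hull E \<subseteq> Q_polyhedron C"
    by (intro hull_minimal E convex_Q_polyhedron)
  with r(3) have z: "z \<in> Q_polyhedron C" by blast
  have "0 \<le> r \<bullet> c" if "c \<in> C" for c
    using nonneg_inner_nonneg[OF r(2)] C that by blast
  with z r(2) have z2: "z + 2 *\<^sub>R r \<in> Q_polyhedron C"
    by (auto simp: Q_polyhedron_def inner_add_left intro: add_increasing2)
  (* Otherwise x is the midpoint of the points z and z + 2 r of the polyhedron. *)
  have "r = 0"
  proof (rule ccontr)
    assume "r \<noteq> 0"
    have "x = (1 - 1 / 2) *\<^sub>R z + (1 / 2 :: real) *\<^sub>R (z + 2 *\<^sub>R r)"
      unfolding r(1) by (simp add: algebra_simps flip: scaleR_add_left)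
    with \<open>r \<noteq> 0\<close> have "x \<in> open_segment z (z + 2 *\<^sub>R r)"
      unfolding in_segment by (intro conjI exI[of _ "1 / 2"]) auto
    with x z z2 show False by (auto simp: extreme_point_of_def)
  qed
  then have "x \<in> convex hull E" using r by simp
  with x hull have "x extreme_point_of (convex hull E)" by (auto simp: extreme_point_of_def)
  then show "x \<in> E" by (rule extreme_point_of_convex_hull)
qed

section \<open>The weights of the irreducible components\<close>

lemma inv_vec_nth: "inv_vec b $ i = inverse (real (Poly_Mapping.lookup b i))"
proof -
  let ?A = "{k. Poly_Mapping.lookup b k \<ge> 1}"
  have "inv_vec b $ i = (\<Sum>k\<in>?A. if k = i then inverse (real (Poly_Mapping.lookup b k)) else 0)"
    unfolding inv_vec_def sum_component by (intro sum.cong) (simp_all add: axis_def)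
  also have "\<dots> = (if i \<in> ?A then inverse (real (Poly_Mapping.lookup b i)) else 0)"
    by (rule sum.delta) simp
  also have "\<dots> = inverse (real (Poly_Mapping.lookup b i))" by (simp add: not_le)
  finally show ?thesis .
qed

lemma inv_vec_nonneg: "0 \<le> inv_vec b $ i"
  by (simp add: inv_vec_nth)

lemma weight_inv_vec:
  "weight (inv_vec b) a = (\<Sum>i\<in>UNIV. real (Poly_Mapping.lookup a i) / real (Poly_Mapping.lookup b i))"
  by (simp add: weight_eq_sum inv_vec_nth divide_inverse mult.commute)

lemma weight_inv_vec_ge_1:
  assumes "(monomial a :: ('n::finite, 'k::comm_ring_1) mpoly) \<in> q_ideal b"
  shows "1 \<le> weight (inv_vec b) a"
proof -
  obtain i where i: "i \<in> Poly_Mapping.keys b" "Poly_Mapping.lookup b i \<le> Poly_Mapping.lookup a i"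
    using assms unfolding monomial_in_q_ideal_iff by blast
  then have "1 \<le> real (Poly_Mapping.lookup a i) / real (Poly_Mapping.lookup b i)"
    by (simp add: in_keys_iff)
  also have "\<dots> \<le> weight (inv_vec b) a"
    unfolding weight_inv_vec by (rule member_le_sum) auto
  finally show ?thesis .
qed

lemma q_ideal_weight:
  "(q_ideal b :: ('n::finite, 'k::comm_ring_1) mpoly set) \<subseteq> supported_on {a. 1 \<le> weight (inv_vec b) a}"
proof
  fix f :: "('n, 'k) mpoly" assume "f \<in> q_ideal b"
  then have "\<forall>a\<in>Poly_Mapping.keys f. (monomial a :: ('n, 'k) mpoly) \<in> q_ideal b"
    using monomial_ideal_mem_iff[OF monomial_ideal_q_ideal] by blast
  then show "f \<in> supported_on {a. 1 \<le> weight (inv_vec b) a}"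
    using weight_inv_vec_ge_1 unfolding supported_on_def by blast
qed

text \<open>Up to the number of variables, the weight decides membership of a monomial in a power of the
  irreducible ideal: rounding each quotient of exponents down loses at most \<open>1\<close>.\<close>

lemma monomial_in_q_ideal_power_if_weight:
  assumes "real (n + CARD('n)) \<le> weight (inv_vec b) a"
  shows "(monomial a :: ('n::finite, 'k::comm_ring_1) mpoly) \<in> ideal_power (q_ideal b) n"
proof (rule monomial_in_q_ideal_power)
  have "real (n + CARD('n)) \<le> (\<Sum>i\<in>UNIV. real (Poly_Mapping.lookup a i) / real (Poly_Mapping.lookup b i))"
    using assms by (simp add: weight_inv_vec)
  also have "\<dots> \<le> (\<Sum>i\<in>(UNIV :: 'n set). real (Poly_Mapping.lookup a i div Poly_Mapping.lookup b i) + 1)"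
  proof (rule sum_mono)
    fix i
    show "real (Poly_Mapping.lookup a i) / real (Poly_Mapping.lookup b i)
        \<le> real (Poly_Mapping.lookup a i div Poly_Mapping.lookup b i) + 1"
      using floor_divide_of_nat_eq[of "Poly_Mapping.lookup a i" "Poly_Mapping.lookup b i", where 'a = real]
      by linarith
  qed
  also have "\<dots> = real ((\<Sum>i\<in>UNIV. Poly_Mapping.lookup a i div Poly_Mapping.lookup b i) + CARD('n))"
    by (simp add: sum.distrib)
  finally show "n \<le> (\<Sum>i\<in>UNIV. Poly_Mapping.lookup a i div Poly_Mapping.lookup b i)"
    by linarith
qed

lemma monomial_in_Inter_q_ideal:
  fixes \<alpha> :: "'m::finite \<Rightarrow> 'n expo"
  assumes "\<And>j. \<alpha> j \<noteq> 0"
  shows "(monomial (sum \<alpha> UNIV) :: ('n, 'k::comm_ring_1) mpoly) \<in> (\<Inter>j. q_ideal (\<alpha> j))"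
proof
  fix j
  obtain i where "i \<in> Poly_Mapping.keys (\<alpha> j)"
    using assms[of j] by (metis in_keys_iff lookup_zero poly_mapping_eqI)
  moreover have "Poly_Mapping.lookup (\<alpha> j) i \<le> Poly_Mapping.lookup (sum \<alpha> UNIV) i"
    unfolding lookup_sum by (rule member_le_sum) auto
  ultimately show "(monomial (sum \<alpha> UNIV) :: ('n, 'k) mpoly) \<in> q_ideal (\<alpha> j)"
    unfolding monomial_in_q_ideal_iff by blast
qed

section \<open>Equality of the Newton polyhedron and the irreducible polyhedron\<close>

text \<open>A generator lies in every component, so one of its exponents reaches the exponent that bounds
  it there, and this already contributes \<open>1\<close> to the weight.\<close>

lemma newton_subset_irreducible_polyhedron:
  fixes \<alpha> :: "'m::finite \<Rightarrow> 'n::finite expo"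
  defines "I \<equiv> (\<Inter>j. q_ideal (\<alpha> j) :: ('n, 'k::comm_ring_1) mpoly set)"
  assumes I: "monomial_ideal I"
  shows "newton_polyhedron I \<subseteq> Q_polyhedron (range (\<lambda>j. inv_vec (\<alpha> j)))"
proof
  fix x assume "x \<in> newton_polyhedron I"
  then have x: "x \<in> dominant (expo_vec ` minimal_generators I)" by (simp add: newton_polyhedron_eq_dominant)
  have "1 \<le> inv_vec (\<alpha> j) \<bullet> x" for j
  proof (rule inner_dominant_ge[OF _ _ x])
    show "\<forall>c\<in>expo_vec ` minimal_generators I. 1 \<le> inv_vec (\<alpha> j) \<bullet> c"
    proof
      fix c assume "c \<in> expo_vec ` minimal_generators I"
      then obtain g where g: "g \<in> minimal_generators I" "c = expo_vec g" by blast
      then have "(monomial g :: ('n, 'k) mpoly) \<in> I" by (simp add: minimal_generators_eq(1)[OF I])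
      then have "(monomial g :: ('n, 'k) mpoly) \<in> q_ideal (\<alpha> j)" by (auto simp: I_def)
      then show "1 \<le> inv_vec (\<alpha> j) \<bullet> c"
        using weight_inv_vec_ge_1 unfolding g(2) weight_def by blast
    qed
  qed (simp add: inv_vec_nonneg)
  moreover have "0 \<le> x $ i" for i
    by (rule dominant_nonneg[OF _ x]) (auto simp: expo_vec_def)
  ultimately show "x \<in> Q_polyhedron (range (\<lambda>j. inv_vec (\<alpha> j)))"
    by (auto simp: Q_polyhedron_def inner_commute)
qed

text \<open>A point \<open>x\<close> of the irreducible polyhedron outside the Newton polyhedron is cut off by a
  weight \<open>y\<close> that is at least \<open>c\<close> on \<open>I\<close> and less than \<open>c\<close> at \<open>x\<close>. Rounding up \<open>(n + s) * x\<close>, with \<open>s\<close>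
  the number of variables, gives a monomial in the \<open>n\<close>-th power of every component, so in the
  \<open>n\<close>-th power of \<open>I\<close>, and its weight is at least \<open>n * c\<close>. For large \<open>n\<close> this is a contradiction.\<close>

lemma irreducible_subset_newton_polyhedron:
  fixes I :: "('n::finite, 'k::comm_ring_1) mpoly set" and \<alpha> :: "'m \<Rightarrow> 'n expo"
  assumes I: "monomial_ideal I" "I \<noteq> {0}"
    and powers: "\<And>n. n \<ge> 1 \<Longrightarrow> (\<Inter>j. ideal_power (q_ideal (\<alpha> j)) n) \<subseteq> ideal_power I n"
  shows "Q_polyhedron (range (\<lambda>j. inv_vec (\<alpha> j))) \<subseteq> newton_polyhedron I"
proof
  fix x assume x: "x \<in> Q_polyhedron (range (\<lambda>j. inv_vec (\<alpha> j)))"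
  then have x0: "\<And>i. 0 \<le> x $ i" and x1: "\<And>j. 1 \<le> inv_vec (\<alpha> j) \<bullet> x"
    by (auto simp: Q_polyhedron_def inner_commute)
  show "x \<in> newton_polyhedron I"
  proof (rule ccontr)
    assume "x \<notin> newton_polyhedron I"
    moreover have "minimal_generators I \<noteq> {}"
      using I(2) span_minimal_generators[OF I(1)] by (metis ideal.span_empty image_empty)
    ultimately obtain y c where y: "\<forall>i. 0 \<le> y $ i" "y \<bullet> x < c"
      and yc: "\<forall>e\<in>expo_vec ` minimal_generators I. c \<le> y \<bullet> e"
      unfolding newton_polyhedron_eq_dominant
      using dominant_separation[of "expo_vec ` minimal_generators I" x] finite_minimal_generators[OF I(1)]
      by auto
    have y0: "\<And>i. 0 \<le> y $ i" using y(1) by blast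
    have Iy: "I \<subseteq> supported_on {a. c \<le> weight y a}"
    proof
      fix f assume "f \<in> I"
      then have "\<forall>a\<in>Poly_Mapping.keys f. (monomial a :: ('n, 'k) mpoly) \<in> I"
        by (rule monomial_ideal_mem_iff[OF I(1), THEN iffD1])
      then have "\<forall>a\<in>Poly_Mapping.keys f. \<exists>g\<in>minimal_generators I. \<exists>d. a = g + d"
        unfolding monomial_in_iff_minimal_generators[OF I(1)] .
      moreover have "c \<le> weight y (g + d)" if "g \<in> minimal_generators I" for g d
        using yc that weight_nonneg[OF y0, of d] by (simp add: weight_def[of y g] add_increasing2)
      ultimately have "\<forall>a\<in>Poly_Mapping.keys f. c \<le> weight y a" by metis
      then show "f \<in> supported_on {a. c \<le> weight y a}"
        unfolding supported_on_def by blast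
    qed
    let ?s = "real CARD('n)" and ?Y = "\<Sum>i\<in>UNIV. y $ i"
    have bound: "real n * (c - y \<bullet> x) \<le> ?s * (y \<bullet> x) + ?Y" if n: "n \<ge> 1" for n
    proof -
      (* The additional CARD('n) makes up for rounding the quotients of exponents down. *)
      define N where "N = real (n + CARD('n))"
      define a where "a = Abs_poly_mapping (\<lambda>i. nat \<lceil>N * x $ i\<rceil>)"
      have a: "Poly_Mapping.lookup a i = nat \<lceil>N * x $ i\<rceil>" for i
        unfolding a_def by (subst lookup_Abs_poly_mapping) auto
      have N: "0 \<le> N * x $ i" for i using x0 by (simp add: N_def)
      have lower: "N * x $ i \<le> real (Poly_Mapping.lookup a i)"
        and upper: "real (Poly_Mapping.lookup a i) \<le> N * x $ i + 1" for i
        unfolding a using N[of i] by linarith+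
      have "(monomial a :: ('n, 'k) mpoly) \<in> ideal_power (q_ideal (\<alpha> j)) n" for j
      proof (rule monomial_in_q_ideal_power_if_weight)
        have "real (n + CARD('n)) \<le> N * (inv_vec (\<alpha> j) \<bullet> x)"
          using x1[of j] by (simp add: N_def mult_le_cancel_left1)
        also have "\<dots> = (\<Sum>i\<in>UNIV. inv_vec (\<alpha> j) $ i * (N * x $ i))"
          by (simp add: inner_vec_def sum_distrib_left mult_ac)
        also have "\<dots> \<le> weight (inv_vec (\<alpha> j)) a"
          unfolding weight_eq_sum by (intro sum_mono mult_left_mono lower inv_vec_nonneg)
        finally show "real (n + CARD('n)) \<le> weight (inv_vec (\<alpha> j)) a" .
      qed
      then have "(monomial a :: ('n, 'k) mpoly) \<in> ideal_power I n" using powers[OF n] by blast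
      then have "real n * c \<le> weight y a"
        using ideal_power_weight[OF y0 Iy, of n] by auto
      also have "\<dots> \<le> (\<Sum>i\<in>UNIV. y $ i * (N * x $ i + 1))"
        unfolding weight_eq_sum by (intro sum_mono mult_left_mono upper y0)
      also have "\<dots> = N * (y \<bullet> x) + ?Y"
        by (simp add: inner_vec_def sum_distrib_left algebra_simps sum.distrib)
      finally show ?thesis by (simp add: N_def algebra_simps)
    qed
    obtain n where n: "?s * (y \<bullet> x) + ?Y < real n * (c - y \<bullet> x)"
      using ex_less_of_nat_mult[of "c - y \<bullet> x"] y(2) by auto
    also have "\<dots> \<le> real (Suc n) * (c - y \<bullet> x)" using y(2) by (intro mult_right_mono) auto
    finally show False using bound[of "Suc n"] by simp
  qed
qed

section \<open>Integral closures of powers\<close>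

lemma ideal_mult_assoc_subset:
  "ideal_mult I (ideal_mult J L) \<subseteq> ideal_mult (ideal_mult I J) (L :: 'a::comm_ring_1 set)"
proof (rule ideal_mult_least)
  fix x z assume x: "x \<in> I" and z: "z \<in> ideal_mult J L"
  let ?M = "ideal_mult (ideal_mult I J) L"
  have "ideal_mult J L \<subseteq> {z. x * z \<in> ?M}"
  proof (rule ideal_mult_least)
    show "ideal.subspace {z. x * z \<in> ?M}"
      unfolding ideal.subspace_def
    proof (intro conjI ballI allI)
      fix r z assume "z \<in> {z. x * z \<in> ?M}"
      then have "x * z \<in> ?M" by (rule CollectD)
      then have "r * (x * z) \<in> ?M" by (rule ideal.subspace_scale[OF subspace_ideal_mult])
      then show "r * z \<in> {z. x * z \<in> ?M}" by (simp add: mult.left_commute)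
    qed (auto simp: distrib_left intro: ideal.subspace_0 ideal.subspace_add[OF subspace_ideal_mult])
    fix y w assume "y \<in> J" "w \<in> L"
    then have "(x * y) * w \<in> ?M" using x by (intro ideal_mult_memI)
    then show "y * w \<in> {z. x * z \<in> ?M}" by (simp add: mult.assoc)
  qed
  with z show "x * z \<in> ?M" by blast
qed simp

text \<open>If \<open>I\<close> is the intersection of the components and its Newton polyhedron is the irreducible polyhedron,
  then this ideal turns out to be the integral closure of the \<open>k\<close>-th power of \<open>I\<close>.\<close>

definition weight_ideal :: "('m \<Rightarrow> 'n::finite expo) \<Rightarrow> nat \<Rightarrow> ('n, 'k::comm_ring_1) mpoly set" where
  "weight_ideal \<alpha> k = supported_on {a. \<forall>j. real k \<le> weight (inv_vec (\<alpha> j)) a}"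

lemma monomial_ideal_weight_ideal: "monomial_ideal (weight_ideal \<alpha> k)"
  unfolding monomial_ideal_iff weight_ideal_def
  by (intro exI conjI refl)
     (auto simp: upset_def intro: add_increasing2 weight_nonneg inv_vec_nonneg)

text \<open>If the weighted inequalities describe the Newton polyhedron, then the exponent vector of a
  monomial of weight at least \<open>k + 1\<close> is \<open>k + 1\<close> times a convex combination of generators, up to a nonnegative
  vector. When \<open>k + 1\<close> is at least the number of generators, some generator has a coefficient
  of at least \<open>1\<close> and can be split off, and what remains still has weight at least \<open>k\<close>.\<close>

lemma split_off_generator:
  fixes I :: "('n::finite, 'k::comm_ring_1) mpoly set" and \<alpha> :: "'m \<Rightarrow> 'n expo"
  assumes I: "monomial_ideal I"
    and NP: "newton_polyhedron I = Q_polyhedron (range (\<lambda>j. inv_vec (\<alpha> j)))"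
    and k: "card (minimal_generators I) \<le> Suc k"
    and a: "\<And>j. real (Suc k) \<le> weight (inv_vec (\<alpha> j)) a"
  obtains v d where "v \<in> minimal_generators I" "a = v + d" "\<And>j. real k \<le> weight (inv_vec (\<alpha> j)) d"
proof -
  let ?G = "expo_vec ` minimal_generators I" and ?K = "real (Suc k)"
  have fin: "finite ?G" using finite_minimal_generators[OF I] by simp
  have G0: "0 \<le> p $ i" if "p \<in> ?G" for p i using that by (auto simp: expo_vec_def)
  have "(1 / ?K) *\<^sub>R expo_vec a \<in> Q_polyhedron (range (\<lambda>j. inv_vec (\<alpha> j)))"
    using a by (auto simp: Q_polyhedron_def weight_def inner_commute expo_vec_def field_simps)
  then obtain r z where rz: "(1 / ?K) *\<^sub>R expo_vec a = r + z" "\<forall>i. 0 \<le> r $ i" "z \<in> convex hull ?G"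
    unfolding NP[symmetric] newton_polyhedron_def by blast
  then obtain u where u: "\<And>p. p \<in> ?G \<Longrightarrow> 0 \<le> u p" "sum u ?G = 1" "z = (\<Sum>p\<in>?G. u p *\<^sub>R p)"
    unfolding convex_hull_finite[OF fin] by blast
  have "\<exists>p\<in>?G. 1 \<le> ?K * u p"
  proof (rule ccontr)
    assume *: "\<not> (\<exists>p\<in>?G. 1 \<le> ?K * u p)"
    have "?G \<noteq> {}" using u(2) by auto
    then have "(\<Sum>p\<in>?G. ?K * u p) < (\<Sum>p\<in>?G. 1)"
      using * fin by (intro sum_strict_mono) auto
    also have "\<dots> \<le> real (card (minimal_generators I))"
      using card_image_le[OF finite_minimal_generators[OF I]] by simp
    also have "\<dots> \<le> ?K" using k by linarith
    finally show False using u(2) by (simp flip: sum_distrib_left)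
  qed
  then obtain v where v: "v \<in> minimal_generators I" "1 \<le> ?K * u (expo_vec v)" by blast
  have ea: "expo_vec a = ?K *\<^sub>R r + (\<Sum>p\<in>?G. (?K * u p) *\<^sub>R p)"
  proof -
    have "expo_vec a = ?K *\<^sub>R ((1 / ?K) *\<^sub>R expo_vec a)" by simp
    also have "\<dots> = ?K *\<^sub>R r + (\<Sum>p\<in>?G. (?K * u p) *\<^sub>R p)"
      unfolding rz(1) u(3) by (simp only: scaleR_add_right scaleR_sum_right scaleR_scaleR)
    finally show ?thesis .
  qed
  have "(\<Sum>p\<in>?G. (?K * u p) *\<^sub>R p)
      = (\<Sum>p\<in>?G. (?K * u p - (if p = expo_vec v then 1 else 0)) *\<^sub>R p) + expo_vec v"
    using v(1) fin by (simp add: scaleR_diff_left sum_subtractf if_distrib[of "\<lambda>x. x *\<^sub>R _"] sum.delta' cong: if_cong)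
  with ea have split: "expo_vec a = ?K *\<^sub>R r + (\<Sum>p\<in>?G. (?K * u p - (if p = expo_vec v then 1 else 0)) *\<^sub>R p) + expo_vec v"
    (is "_ = _ + (\<Sum>p\<in>_. ?m p *\<^sub>R p) + _") by simp
  have m: "0 \<le> ?m p" if "p \<in> ?G" for p using u(1)[OF that] v(2) by auto
  have "expo_vec v $ i \<le> expo_vec a $ i" for i
  proof -
    have "0 \<le> (\<Sum>p\<in>?G. ?m p * p $ i)"
      by (intro sum_nonneg mult_nonneg_nonneg m G0)
    moreover have "0 \<le> ?K * r $ i" using rz(2) by simp
    ultimately show ?thesis unfolding split by (simp del: of_nat_Suc)
  qed
  then have "\<forall>i. Poly_Mapping.lookup v i \<le> Poly_Mapping.lookup a i" by (simp add: expo_vec_def)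
  then obtain d where d: "a = v + d" unfolding expo_divides_iff[symmetric] by blast
  have "real k \<le> weight (inv_vec (\<alpha> j)) d" for j
  proof -
    let ?w = "inv_vec (\<alpha> j)"
    have w: "\<forall>i. 0 \<le> ?w $ i" by (simp add: inv_vec_nonneg)
    have "expo_vec d = ?K *\<^sub>R r + (\<Sum>p\<in>?G. ?m p *\<^sub>R p)"
      using split unfolding d expo_vec_add by simp
    then have "weight ?w d = ?K * (?w \<bullet> r) + (\<Sum>p\<in>?G. ?m p * (?w \<bullet> p))"
      by (simp only: weight_def inner_add_right inner_scaleR_right inner_sum_right)
    moreover have "0 \<le> ?K * (?w \<bullet> r)" using nonneg_inner_nonneg[OF w rz(2)] by simp
    moreover have "(\<Sum>p\<in>?G. ?m p) \<le> (\<Sum>p\<in>?G. ?m p * (?w \<bullet> p))"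
    proof (rule sum_mono)
      fix p assume p: "p \<in> ?G"
      have "p \<in> newton_polyhedron I"
        unfolding newton_polyhedron_def using hull_inc[OF p, of convex] by (intro CollectI exI[of _ 0] exI[of _ p]) simp
      then have "1 \<le> ?w \<bullet> p" unfolding NP by (auto simp: Q_polyhedron_def inner_commute)
      then show "?m p \<le> ?m p * (?w \<bullet> p)" using m[OF p] mult_left_mono[of 1 "?w \<bullet> p" "?m p"] by simp
    qed
    moreover have "(\<Sum>p\<in>?G. ?m p) = real k"
      using v(1) fin u(2) by (simp add: sum_subtractf sum.delta' flip: sum_distrib_left)
    ultimately show ?thesis by linarith
  qed
  then show thesis using that v(1) d by blast
qed

lemma weight_ideal_Suc_subset:
  fixes I :: "('n::finite, 'k::comm_ring_1) mpoly set" and \<alpha> :: "'m \<Rightarrow> 'n expo"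
  assumes I: "monomial_ideal I"
    and NP: "newton_polyhedron I = Q_polyhedron (range (\<lambda>j. inv_vec (\<alpha> j)))"
    and k: "card (minimal_generators I) \<le> Suc k"
  shows "weight_ideal \<alpha> (Suc k) \<subseteq> ideal_mult I (weight_ideal \<alpha> k)"
proof
  fix f :: "('n, 'k) mpoly" assume f: "f \<in> weight_ideal \<alpha> (Suc k)"
  have "(\<Sum>a\<in>Poly_Mapping.keys f. Poly_Mapping.single a (Poly_Mapping.lookup f a)) \<in> ideal_mult I (weight_ideal \<alpha> k)"
  proof (rule ideal.subspace_sum[OF subspace_ideal_mult])
    fix a assume "a \<in> Poly_Mapping.keys f"
    with f have "\<And>j. real (Suc k) \<le> weight (inv_vec (\<alpha> j)) a"
      unfolding weight_ideal_def supported_on_def by blast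
    then obtain v d where v: "v \<in> minimal_generators I" "a = v + d"
      and d: "\<And>j. real k \<le> weight (inv_vec (\<alpha> j)) d"
      using split_off_generator[OF I NP k] by blast
    have "(monomial v :: ('n, 'k) mpoly) \<in> I" using v(1) by (simp add: minimal_generators_eq(1)[OF I])
    moreover have "Poly_Mapping.single d (Poly_Mapping.lookup f a) \<in> weight_ideal \<alpha> k"
      using d by (auto simp: weight_ideal_def supported_on_def)
    ultimately have "monomial v * Poly_Mapping.single d (Poly_Mapping.lookup f a) \<in> ideal_mult I (weight_ideal \<alpha> k)"
      by (rule ideal_mult_memI)
    then show "Poly_Mapping.single a (Poly_Mapping.lookup f a) \<in> ideal_mult I (weight_ideal \<alpha> k)"
      by (simp add: v(2) monomial_def mult_single)
  qed
  then show "f \<in> ideal_mult I (weight_ideal \<alpha> k)" by (simp add: sum_single_eq)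
qed

lemma weight_ideal_add_subset:
  fixes I :: "('n::finite, 'k::comm_ring_1) mpoly set" and \<alpha> :: "'m \<Rightarrow> 'n expo"
  assumes "monomial_ideal I"
    and "newton_polyhedron I = Q_polyhedron (range (\<lambda>j. inv_vec (\<alpha> j)))"
    and "card (minimal_generators I) \<le> Suc k"
  shows "weight_ideal \<alpha> (k + n) \<subseteq> ideal_mult (ideal_power I n) (weight_ideal \<alpha> k)"
proof (induction n)
  case 0
  show ?case
  proof
    fix f :: "('n, 'k) mpoly" assume "f \<in> weight_ideal \<alpha> (k + 0)"
    then show "f \<in> ideal_mult (ideal_power I 0) (weight_ideal \<alpha> k)"
      using ideal_mult_memI[of 1 UNIV f "weight_ideal \<alpha> k"] by simp
  qed
next
  case (Suc n)
  have "weight_ideal \<alpha> (Suc (k + n)) \<subseteq> ideal_mult I (weight_ideal \<alpha> (k + n))"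
    using assms by (intro weight_ideal_Suc_subset) auto
  also have "\<dots> \<subseteq> ideal_mult I (ideal_mult (ideal_power I n) (weight_ideal \<alpha> k))"
    by (rule ideal_mult_mono[OF order_refl Suc])
  also have "\<dots> \<subseteq> ideal_mult (ideal_power I (Suc n)) (weight_ideal \<alpha> k)"
    unfolding ideal_power.simps by (rule ideal_mult_assoc_subset)
  finally show ?case by simp
qed

text \<open>For large \<open>k\<close>, an element of the weight ideal of \<open>n\<close> multiplies the finitely generated weight ideal of \<open>k\<close>
  into that of \<open>k + n\<close>, hence into \<open>I\<^sup>n\<close> times itself, and the determinant trick applies. This treats
  polynomials with several terms directly, without showing first that sums of integral elements are integral.\<close>

lemma weight_ideal_subset_integral_closure:
  fixes I :: "('n::{finite,linorder}, 'k::field) mpoly set" and \<alpha> :: "'m \<Rightarrow> 'n expo"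
  assumes I: "monomial_ideal I" "I \<noteq> {0}"
    and NP: "newton_polyhedron I = Q_polyhedron (range (\<lambda>j. inv_vec (\<alpha> j)))"
  shows "weight_ideal \<alpha> n \<subseteq> integral_closure (ideal_power I n)"
proof
  fix f :: "('n, 'k) mpoly" assume f: "f \<in> weight_ideal \<alpha> n"
  define k where "k = card (minimal_generators I)"
  let ?N = "weight_ideal \<alpha> k :: ('n, 'k) mpoly set"
  let ?V = "monomial ` minimal_generators ?N :: ('n, 'k) mpoly set"
  have span: "ideal.span ?V = ?N"
    using span_minimal_generators[OF monomial_ideal_weight_ideal] by metis
  have "minimal_generators I \<noteq> {}"
    using I(2) span_minimal_generators[OF I(1)] by (metis ideal.span_empty image_empty)
  then obtain g where g: "g \<in> minimal_generators I" by blast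
  have "expo_vec g \<in> newton_polyhedron I"
    unfolding newton_polyhedron_def using hull_inc[of "expo_vec g" _ convex] g
    by (intro CollectI exI[of _ 0] exI[of _ "expo_vec g"]) simp
  then have "1 \<le> weight (inv_vec (\<alpha> j)) g" for j
    unfolding NP by (auto simp: Q_polyhedron_def weight_def inner_commute)
  then have "(monomial g :: ('n, 'k) mpoly) \<in> supported_on {a. 1 \<le> weight (inv_vec (\<alpha> j)) a}" for j
    by simp
  then have "(monomial g :: ('n, 'k) mpoly) ^ k \<in> supported_on {a. real k * 1 \<le> weight (inv_vec (\<alpha> j)) a}" for j
    by (rule power_weight[OF inv_vec_nonneg])
  then have "(monomial g :: ('n, 'k) mpoly) ^ k \<in> ?N"
    unfolding weight_ideal_def supported_on_def by fastforce
  moreover have nz: "(monomial b :: ('n, 'k) mpoly) \<noteq> 0" for b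
    using keys_monomial[of b, where 'k = 'k] by (metis insert_not_empty keys_zero)
  ultimately have "minimal_generators ?N \<noteq> {}"
    using span by (metis ideal.span_empty image_empty power_not_zero singletonD)
  then obtain b where "b \<in> minimal_generators ?N" by blast
  then have b: "monomial b \<in> ?V" by blast
  show "f \<in> integral_closure (ideal_power I n)"
  proof (rule integral_closure_if_multiplies[OF subspace_ideal_power _ b nz])
    show "finite ?V" by (intro finite_imageI finite_minimal_generators monomial_ideal_weight_ideal)
    fix v assume "v \<in> ?V"
    then have "v \<in> ideal.span ?V" by (rule ideal.span_base)
    then have v: "v \<in> ?N" by (simp only: span)
    have "f * v \<in> weight_ideal \<alpha> (k + n)"
      using f v unfolding weight_ideal_def by (rule supported_on_mult) (simp add: add_mono add.commute[of "real k"])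
    then show "f * v \<in> ideal_mult (ideal_power I n) (ideal.span ?V)"
      unfolding span using weight_ideal_add_subset[OF I(1) NP, of k n] k_def by auto
  qed
qed

lemma integral_closure_Inter_q_ideal_power:
  fixes \<alpha> :: "'m::finite \<Rightarrow> 'n::{finite,linorder} expo"
  defines "I \<equiv> (\<Inter>j. q_ideal (\<alpha> j) :: ('n, 'k::field) mpoly set)"
  assumes I: "monomial_ideal I" "I \<noteq> {0}"
    and NP: "newton_polyhedron I = Q_polyhedron (range (\<lambda>j. inv_vec (\<alpha> j)))"
  shows "integral_closure (ideal_power I n) = (\<Inter>j. integral_closure (ideal_power (q_ideal (\<alpha> j)) n))"
proof
  show "integral_closure (ideal_power I n) \<subseteq> (\<Inter>j. integral_closure (ideal_power (q_ideal (\<alpha> j)) n))"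
    by (intro INT_greatest integral_closure_mono ideal_power_mono) (auto simp: I_def)
  have "ideal_power (q_ideal (\<alpha> j) :: ('n, 'k) mpoly set) n
      \<subseteq> supported_on {a. real n * 1 \<le> weight (inv_vec (\<alpha> j)) a}" for j
    by (rule ideal_power_weight[OF inv_vec_nonneg q_ideal_weight])
  then have "integral_closure (ideal_power (q_ideal (\<alpha> j) :: ('n, 'k) mpoly set) n)
      \<subseteq> supported_on {a. real n \<le> weight (inv_vec (\<alpha> j)) a}" for j
    by (intro integral_closure_weight inv_vec_nonneg) simp
  then have "(\<Inter>j. integral_closure (ideal_power (q_ideal (\<alpha> j) :: ('n, 'k) mpoly set) n)) \<subseteq> weight_ideal \<alpha> n"
    unfolding weight_ideal_def supported_on_def by blast
  also have "\<dots> \<subseteq> integral_closure (ideal_power I n)"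
    by (rule weight_ideal_subset_integral_closure[OF I NP])
  finally show "(\<Inter>j. integral_closure (ideal_power (q_ideal (\<alpha> j)) n)) \<subseteq> integral_closure (ideal_power I n)" .
qed

section \<open>Vertices of the covering polyhedron\<close>

lemma covering_polyhedron_ge_1:
  fixes I :: "('n::finite, 'k::comm_ring_1) mpoly set"
  assumes I: "monomial_ideal I" and x: "x \<in> covering_polyhedron I" and a: "monomial a \<in> I"
  shows "1 \<le> weight x a"
proof -
  obtain g d where g: "g \<in> minimal_generators I" "a = g + d"
    using a unfolding monomial_in_iff_minimal_generators[OF I] by blast
  have "1 \<le> weight x g" using x g(1) by (auto simp: covering_polyhedron_def Q_polyhedron_def weight_def)
  moreover have "0 \<le> weight x d"
    using x by (intro weight_nonneg) (auto simp: covering_polyhedron_def Q_polyhedron_def)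
  ultimately show ?thesis by (simp add: g(2))
qed

lemma inv_vec_in_covering_polyhedron:
  fixes \<alpha> :: "'m::finite \<Rightarrow> 'n::finite expo"
  defines "I \<equiv> (\<Inter>j. q_ideal (\<alpha> j) :: ('n, 'k::comm_ring_1) mpoly set)"
  assumes I: "monomial_ideal I"
  shows "inv_vec (\<alpha> j) \<in> covering_polyhedron I"
proof -
  have "1 \<le> weight (inv_vec (\<alpha> j)) g" if "g \<in> minimal_generators I" for g
  proof (rule weight_inv_vec_ge_1)
    have "(monomial g :: ('n, 'k) mpoly) \<in> I" using that by (simp add: minimal_generators_eq(1)[OF I])
    then show "(monomial g :: ('n, 'k) mpoly) \<in> q_ideal (\<alpha> j)" by (auto simp: I_def)
  qed
  then show ?thesis by (auto simp: covering_polyhedron_def Q_polyhedron_def weight_def inv_vec_nonneg)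
qed

text \<open>For \<open>i\<close> in the support of \<open>\<alpha> k\<close>, the intersection contains a monomial in which \<open>i\<close> is the only variable from
  this support, with exponent \<open>\<alpha> k i\<close>. On the face where the coordinates outside the support vanish, the
  inequality of this monomial bounds the coordinate \<open>i\<close> below by the inverse of \<open>\<alpha> k i\<close>.\<close>

lemma inv_vec_least_on_face:
  fixes \<alpha> :: "'m::finite \<Rightarrow> 'n::finite expo"
  defines "I \<equiv> (\<Inter>j. q_ideal (\<alpha> j) :: ('n, 'k::comm_ring_1) mpoly set)"
  assumes I: "monomial_ideal I"
    and inc: "\<And>j. j \<noteq> k \<Longrightarrow> \<not> Poly_Mapping.keys (\<alpha> j) \<subseteq> Poly_Mapping.keys (\<alpha> k)"
    and x: "x \<in> covering_polyhedron I" "\<And>i. i \<notin> Poly_Mapping.keys (\<alpha> k) \<Longrightarrow> x $ i = 0"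
  shows "inv_vec (\<alpha> k) $ i \<le> x $ i"
proof (cases "i \<in> Poly_Mapping.keys (\<alpha> k)")
  case True
  let ?n = "Poly_Mapping.lookup (\<alpha> k) i"
  obtain a where a: "\<And>i. i \<in> Poly_Mapping.keys (\<alpha> k) \<Longrightarrow> Poly_Mapping.lookup a i = 0"
    "\<And>f :: ('n, 'k) mpoly. f \<in> q_ideal (\<alpha> k) \<Longrightarrow> monomial a * f \<in> I"
    using multiplier_into_Inter_q_ideal[of k \<alpha>, OF inc] unfolding I_def by metis
  have "(monomial (Poly_Mapping.single i ?n) :: ('n, 'k) mpoly) \<in> q_ideal (\<alpha> k)"
    unfolding monomial_in_q_ideal_iff using True by (intro bexI[of _ i]) simp_all
  then have "(monomial (a + Poly_Mapping.single i ?n) :: ('n, 'k) mpoly) \<in> I"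
    using a(2) by (simp flip: monomial_mult)
  then have "1 \<le> weight x a + weight x (Poly_Mapping.single i ?n)"
    using covering_polyhedron_ge_1[OF I x(1)] by fastforce
  moreover have "weight x a = 0"
    unfolding weight_eq_sum using a(1) x(2) by (intro sum.neutral) (metis mult_zero_left mult_zero_right of_nat_0)
  moreover have "weight x (Poly_Mapping.single i ?n) = x $ i * real ?n"
    by (simp add: weight_eq_sum lookup_single when_def if_distrib[of real] if_distrib[of "\<lambda>y. _ * y"] cong: if_cong)
  moreover have "0 < real ?n" using True by (simp add: in_keys_iff)
  ultimately show ?thesis by (simp add: inv_vec_nth field_simps)
next
  case False
  then show ?thesis using x(2) by (simp add: inv_vec_nth in_keys_iff)
qed

text \<open>The ends of a segment through \<open>inv_vec (\<alpha> k)\<close> have no coordinates outside the support of \<open>\<alpha> k\<close>, so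
  none of their coordinates is smaller than that of \<open>inv_vec (\<alpha> k)\<close>, and both ends coincide with it.\<close>

lemma inv_vec_extreme_point:
  fixes \<alpha> :: "'m::finite \<Rightarrow> 'n::finite expo"
  defines "I \<equiv> (\<Inter>j. q_ideal (\<alpha> j) :: ('n, 'k::comm_ring_1) mpoly set)"
  assumes I: "monomial_ideal I"
    and inc: "\<And>j. j \<noteq> k \<Longrightarrow> \<not> Poly_Mapping.keys (\<alpha> j) \<subseteq> Poly_Mapping.keys (\<alpha> k)"
  shows "inv_vec (\<alpha> k) extreme_point_of covering_polyhedron I"
  unfolding extreme_point_of_def
proof (intro conjI ballI notI)
  show "inv_vec (\<alpha> k) \<in> covering_polyhedron I"
    using inv_vec_in_covering_polyhedron[of \<alpha>] I unfolding I_def by blast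
  fix x y assume x: "x \<in> covering_polyhedron I" and y: "y \<in> covering_polyhedron I"
    and "inv_vec (\<alpha> k) \<in> open_segment x y"
  then obtain t where t: "x \<noteq> y" "0 < t" "t < 1" "inv_vec (\<alpha> k) = (1 - t) *\<^sub>R x + t *\<^sub>R y"
    unfolding in_segment by blast
  have comb: "inv_vec (\<alpha> k) $ i = (1 - t) * x $ i + t * y $ i" for i by (simp add: t(4))
  have nonneg: "0 \<le> x $ i" "0 \<le> y $ i" for i
    using x y by (auto simp: covering_polyhedron_def Q_polyhedron_def)
  have "x $ i = 0 \<and> y $ i = 0" if "i \<notin> Poly_Mapping.keys (\<alpha> k)" for i
  proof -
    have "(1 - t) * x $ i + t * y $ i = 0"
      using comb[of i] that by (simp add: inv_vec_nth in_keys_iff)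
    moreover have "0 \<le> (1 - t) * x $ i" "0 \<le> t * y $ i" using t nonneg by auto
    ultimately have "(1 - t) * x $ i = 0" "t * y $ i = 0" by linarith+
    then show ?thesis using t by simp
  qed
  then have le: "inv_vec (\<alpha> k) $ i \<le> x $ i" "inv_vec (\<alpha> k) $ i \<le> y $ i" for i
    using inv_vec_least_on_face[of \<alpha> k x i] inv_vec_least_on_face[of \<alpha> k y i] I inc x y
    unfolding I_def by blast+
  have "x $ i = y $ i" for i
  proof -
    have "(1 - t) * (x $ i - inv_vec (\<alpha> k) $ i) + t * (y $ i - inv_vec (\<alpha> k) $ i) = 0"
      using comb[of i] by (simp add: algebra_simps)
    moreover have "0 \<le> (1 - t) * (x $ i - inv_vec (\<alpha> k) $ i)" "0 \<le> t * (y $ i - inv_vec (\<alpha> k) $ i)"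
      using t le by auto
    ultimately have "(1 - t) * (x $ i - inv_vec (\<alpha> k) $ i) = 0" "t * (y $ i - inv_vec (\<alpha> k) $ i) = 0" by linarith+
    then show ?thesis using t by simp
  qed
  then show False using t(1) by (simp add: Finite_Cartesian_Product.vec_eq_iff)
qed

section \<open>Monomial ideals whose symbolic and ordinary powers agree\<close>

theorem theorem4p1:
  fixes I :: "('n::{finite,linorder}, 'k::field) mpoly set"
    and \<alpha> :: "'m::finite \<Rightarrow> 'n expo"
    and B :: "real ^ 'm ^ ('n::{finite,linorder})"
  assumes "monomial_ideal I"
    and "minimal_irreducible_decomposition I \<alpha>"
    and "\<forall>j. column j B = inv_vec (\<alpha> j)"
    and "\<forall>n\<ge>1. ideal_power I n = symbolic_power I n"
  shows "(\<forall>n\<ge>1. integral_closure (ideal_power I n) =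
             (\<Inter>j. integral_closure (ideal_power (q_ideal (\<alpha> j)) n))) \<and>
         newton_polyhedron I = Q_polyhedron (columns B) \<and>
         vertices (covering_polyhedron I) = range (\<lambda>j. inv_vec (\<alpha> j))"
proof -
  note I = assms(1)
  have eq: "I = (\<Inter>j. q_ideal (\<alpha> j))" and \<alpha>0: "\<And>j. \<alpha> j \<noteq> 0"
    and irredundant: "\<And>j. I \<noteq> (\<Inter>i\<in>UNIV - {j}. q_ideal (\<alpha> i))"
    and rad: "\<And>i j. i \<noteq> j \<Longrightarrow> radical (q_ideal (\<alpha> i) :: ('n, 'k) mpoly set) \<noteq> radical (q_ideal (\<alpha> j))"
    using assms(2) unfolding minimal_irreducible_decomposition_def irreducible_decomposition_def by blast+
  have inj: "inj (\<lambda>j. Poly_Mapping.keys (\<alpha> j))"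
    by (rule injI, rule ccontr) (metis rad radical_q_ideal)
  have "(monomial (sum \<alpha> UNIV) :: ('n, 'k) mpoly) \<in> I"
    unfolding eq by (rule monomial_in_Inter_q_ideal[OF \<alpha>0])
  moreover have "(monomial (sum \<alpha> UNIV) :: ('n, 'k) mpoly) \<noteq> 0"
    by (metis insert_not_empty keys_zero keys_monomial)
  ultimately have I0: "I \<noteq> {0}" by blast
  have "(\<Inter>j. ideal_power (q_ideal (\<alpha> j)) n) \<subseteq> ideal_power I n" if "n \<ge> 1" for n
    using Inter_power_subset_symbolic_power[OF inj, where J = UNIV and 'k = 'k, of n] assms(4) that by (simp flip: eq)
  with newton_subset_irreducible_polyhedron[of \<alpha>, where 'k = 'k] I
  have NP: "newton_polyhedron I = Q_polyhedron (range (\<lambda>j. inv_vec (\<alpha> j)))"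
    by (intro antisym irreducible_subset_newton_polyhedron I I0) (simp_all flip: eq)
  have "ideal_power I 1 = I" by (rule ideal_power_1[OF subspace_monomial_ideal[OF I]])
  then have "symbolic_power I 1 \<subseteq> I" using assms(4) by auto
  then have minimal: "var_prime (Poly_Mapping.keys (\<alpha> j)) \<in> minimal_primes I" for j
    using no_embedded_component[OF inj, of j] irredundant[of j] unfolding eq by blast
  have inv_vec_in: "range (\<lambda>j. inv_vec (\<alpha> j)) \<subseteq> covering_polyhedron I"
    using inv_vec_in_covering_polyhedron[of \<alpha>, where 'k = 'k] I by (auto simp flip: eq)
  have "covering_polyhedron I \<subseteq> dominant (range (\<lambda>j. inv_vec (\<alpha> j)))"
    unfolding covering_polyhedron_def
    by (rule blocking_duality) (use NP in \<open>auto simp: newton_polyhedron_eq_dominant\<close>)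
  then have "vertices (covering_polyhedron I) \<subseteq> range (\<lambda>j. inv_vec (\<alpha> j))"
    using inv_vec_in unfolding covering_polyhedron_def
    by (rule vertices_Q_polyhedron_subset[rotated]) (auto simp: expo_vec_def)
  moreover have "inv_vec (\<alpha> j) \<in> vertices (covering_polyhedron I)" for j
    using inv_vec_extreme_point[of \<alpha> j, where 'k = 'k] supports_incomparable[OF inj minimal[unfolded eq]] I
    unfolding vertices_def by (simp flip: eq)
  ultimately have vertices: "vertices (covering_polyhedron I) = range (\<lambda>j. inv_vec (\<alpha> j))" by blast
  have "integral_closure (ideal_power I n) = (\<Inter>j. integral_closure (ideal_power (q_ideal (\<alpha> j)) n))" for n
    using integral_closure_Inter_q_ideal_power[of \<alpha>, where 'k = 'k] I I0 NP by (simp flip: eq)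
  moreover have "columns B = range (\<lambda>j. inv_vec (\<alpha> j))"
    using assms(3) by (auto simp: columns_def)
  ultimately show ?thesis using NP vertices by simp
qed

end
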